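(* Let $\mathcal{X}$ be a complete and separable metric space and let $\mathcal{Y}\subseteq\mathbb{R}$ be closed. Let $\mathrm{P}_1,\mathrm{P}_2\in\mathcal{M}_1(\mathcal{X}\times\mathcal{Y})$ be probability measures, let $\lambda_1,\lambda_2>0$, and let $k_1,k_2$ be measurable and bounded kernels on $\mathcal{X}$ with separable RKHSs $H_1,H_2$. Put $\kappa:=\max\{\|k_1\|_\infty,\|k_2\|_\infty\}$ and $\tau:=\min\{\lambda_1,\lambda_2\}$. Let $L$ be a convex and Lipschitz continuous loss function with Lipschitz constant $|L|_1$. Then $$\|f_{\mathrm{P}_1,\lambda_1,k_1}-f_{\mathrm{P}_2,\lambda_2,k_2}\|_\infty\le\frac{|L|_1}{\tau}\cdot\left(\kappa^2\cdot\|\mathrm{P}_1-\mathrm{P}_2\|_{tv}+\frac{\kappa^2}{\tau}\cdot|\lambda_1-\lambda_2|+\frac12\cdot\|k_1-k_2\|_\infty+\kappa\cdot\sqrt{\|k_1-k_2\|_\infty}\right).$$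
   Context: All spaces carry their Borel $\sigma$-algebras; $\mathcal{M}_1(\mathcal{X}\times\mathcal{Y})$ is the set of Borel probability measures on $\mathcal{X}\times\mathcal{Y}$. A kernel on $\mathcal{X}$ is a symmetric positive semidefinite function $k:\mathcal{X}\times\mathcal{X}\to\mathbb{R}$; $H$ (with the same index as $k$) denotes its reproducing kernel Hilbert space (RKHS). For a kernel $k$, $\|k\|_\infty:=\sup_{x\in\mathcal{X}}\sqrt{k(x,x)}$, and $k$ is bounded if this is finite. For the difference $k_1-k_2$ of two kernels (generally not a kernel), $\|k_1-k_2\|_\infty:=\sup_{x,x'}|k_1(x,x')-k_2(x,x')|$; for a function $f$ on $\mathcal{X}$, $\|f\|_\infty:=\sup_{x\in\mathcal{X}}|f(x)|$. A loss function is a measurable function $L:\mathcal{X}\times\mathcal{Y}\times\mathbb{R}\to[0,\infty)$. It is convex if $L(x,y,\cdot)$ is convex for all $(x,y)$, and Lipschitz continuous if there is $c\ge0$ with $|L(x,y,t_1)-L(x,y,t_2)|\le c|t_1-t_2|$ for all $x,y,t_1,t_2$; the smallest such $c$ is $|L|_1$. The shifted loss function is $L^\star(x,y,t):=L(x,y,t)-L(x,y,0)$, and $\mathcal{R}_{L^\star,\mathrm{P}}(f):=\mathbb{E}_{\mathrm{P}}[L^\star(X,Y,f(X))]$. The support vector machine (SVM) is $$f_{\mathrm{P},\lambda,k}:=\arg\inf_{f\in H}\ \mathcal{R}_{L^\star,\mathrm{P}}(f)+\lambda\|f\|_H^2,$$ which exists and is unique for $\mathrm{P}\in\mathcal{M}_1(\mathcal{X}\times\mathcal{Y})$,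 $\lambda>0$, $L$ convex and Lipschitz continuous and $k$ bounded and measurable with separable RKHS (the loss $L$ is fixed and omitted from the notation). For a finite signed measure $\nu$, $\|\nu\|_{tv}:=\sup\{\sum_{i=1}^n|\nu(E_i)|: E_1,\dots,E_n \text{ a finite measurable partition of the whole space}\}$ is its total variation norm. *)

theory Defs
  imports "HOL-Analysis.Analysis" "HOL-Probability.Probability"
begin

definition sup_norm :: "('a \<Rightarrow> real) \<Rightarrow> real" where
  "sup_norm f = (SUP x. \<bar>f x\<bar>)"


section \<open>Kernels and reproducing kernel Hilbert spaces\<close>

definition psd_kernel :: "('a \<Rightarrow> 'a \<Rightarrow> real) \<Rightarrow> bool" where
  "psd_kernel k \<longleftrightarrow>
     (\<forall>x x'. k x x' = k x' x) \<and>
     (\<forall>(n::nat) (x :: nat \<Rightarrow> 'a) (c :: nat \<Rightarrow> real).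
        0 \<le> (\<Sum>i<n. \<Sum>j<n. c i * c j * k (x i) (x j)))"

definition bounded_kernel :: "('a \<Rightarrow> 'a \<Rightarrow> real) \<Rightarrow> bool" where
  "bounded_kernel k \<longleftrightarrow> bdd_above (range (\<lambda>x. sqrt (k x x)))"

definition measurable_kernel :: "('a::topological_space \<Rightarrow> 'a \<Rightarrow> real) \<Rightarrow> bool" where
  "measurable_kernel k \<longleftrightarrow> (\<lambda>(x, x'). k x x') \<in> borel_measurable borel"

text \<open>
  This is not \<^const>\<open>sup_norm\<close> of \<open>k\<close>, which is reserved for differences of kernels.
\<close>

definition kernel_norm :: "('a \<Rightarrow> 'a \<Rightarrow> real) \<Rightarrow> real" where
  "kernel_norm k = (SUP x. sqrt (k x x))"

definition ip_norm :: "(('a \<Rightarrow> real) \<Rightarrow> ('a \<Rightarrow> real) \<Rightarrow> real) \<Rightarrow> ('a \<Rightarrow> real) \<Rightarrow> real" where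
  "ip_norm ip f = sqrt (ip f f)"

text \<open>
  The locale \<^locale>\<open>Metric_space\<close> requires symmetry and nonnegativity of the distance on the
  whole type, hence the value \<open>0\<close> off the carrier.
\<close>

definition ip_dist ::
  "('a \<Rightarrow> real) set \<Rightarrow> (('a \<Rightarrow> real) \<Rightarrow> ('a \<Rightarrow> real) \<Rightarrow> real) \<Rightarrow>
    ('a \<Rightarrow> real) \<Rightarrow> ('a \<Rightarrow> real) \<Rightarrow> real" where
  "ip_dist H ip f g = (if f \<in> H \<and> g \<in> H then ip_norm ip (\<lambda>x. f x - g x) else 0)"

locale function_ip_space =
  fixes H :: "('a \<Rightarrow> real) set"
    and ip :: "('a \<Rightarrow> real) \<Rightarrow> ('a \<Rightarrow> real) \<Rightarrow> real"
  assumes zero_mem: "(\<lambda>_. 0) \<in> H"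
    and add_mem: "\<And>f g. f \<in> H \<Longrightarrow> g \<in> H \<Longrightarrow> (\<lambda>x. f x + g x) \<in> H"
    and scale_mem: "\<And>c f. f \<in> H \<Longrightarrow> (\<lambda>x. c * f x) \<in> H"
    and ip_commute: "\<And>f g. f \<in> H \<Longrightarrow> g \<in> H \<Longrightarrow> ip f g = ip g f"
    and ip_add_left: "\<And>f g h. f \<in> H \<Longrightarrow> g \<in> H \<Longrightarrow> h \<in> H \<Longrightarrow>
      ip (\<lambda>x. f x + g x) h = ip f h + ip g h"
    and ip_scale_left: "\<And>c f h. f \<in> H \<Longrightarrow> h \<in> H \<Longrightarrow> ip (\<lambda>x. c * f x) h = c * ip f h"
    and ip_ge_zero: "\<And>f. f \<in> H \<Longrightarrow> 0 \<le> ip f f"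
    and ip_eq_zero: "\<And>f. f \<in> H \<Longrightarrow> ip f f = 0 \<Longrightarrow> f = (\<lambda>_. 0)"
begin

lemma diff_mem: "f \<in> H \<Longrightarrow> g \<in> H \<Longrightarrow> (\<lambda>x. f x - g x) \<in> H"
  using add_mem[of f "\<lambda>x. (-1) * g x"] scale_mem[of g "-1"] by simp

lemma ip_add_right:
  "f \<in> H \<Longrightarrow> g \<in> H \<Longrightarrow> h \<in> H \<Longrightarrow> ip h (\<lambda>x. f x + g x) = ip h f + ip h g"
  by (simp add: ip_commute[of h] add_mem ip_add_left)

lemma ip_scale_right: "f \<in> H \<Longrightarrow> h \<in> H \<Longrightarrow> ip h (\<lambda>x. c * f x) = c * ip h f"
  by (simp add: ip_commute[of h] scale_mem ip_scale_left)

lemma ip_square_expand: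
  assumes "f \<in> H" "g \<in> H"
  shows "ip (\<lambda>x. f x + c * g x) (\<lambda>x. f x + c * g x) = ip f f + 2 * c * ip f g + c\<^sup>2 * ip g g"
  using assms
  by (simp add: ip_add_left ip_add_right ip_scale_left ip_scale_right scale_mem add_mem
      ip_commute[of g f] power2_eq_square)

lemma Cauchy_Schwarz:
  assumes "f \<in> H" "g \<in> H"
  shows "ip f g \<le> ip_norm ip f * ip_norm ip g"
proof (cases "ip g g = 0")
  case True
  then have "g = (\<lambda>x. 0 * f x)" using ip_eq_zero assms by simp
  then have "ip f g = 0" using ip_scale_right[of f f 0] assms by simp
  then show ?thesis by (simp add: ip_norm_def ip_ge_zero assms)
next
  case False
  then have pos: "ip g g > 0" using ip_ge_zero[OF assms(2)] by linarith
  define c where "c = - (ip f g / ip g g)"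
  have "0 \<le> ip f f + 2 * c * ip f g + c\<^sup>2 * ip g g"
    using ip_ge_zero[of "\<lambda>x. f x + c * g x"] ip_square_expand[of f g c]
    by (simp add: add_mem scale_mem assms)
  also have "\<dots> = ip f f - (ip f g)\<^sup>2 / ip g g"
    using pos by (simp add: c_def power2_eq_square field_simps)
  finally have "(ip f g)\<^sup>2 \<le> ip f f * ip g g"
    using pos by (simp add: field_simps)
  then show ?thesis
    by (simp add: ip_norm_def real_le_rsqrt flip: real_sqrt_mult)
qed

lemma ip_norm_triangle:
  assumes "f \<in> H" "g \<in> H"
  shows "ip_norm ip (\<lambda>x. f x + g x) \<le> ip_norm ip f + ip_norm ip g"
proof -
  have "ip (\<lambda>x. f x + g x) (\<lambda>x. f x + g x) = ip f f + 2 * ip f g + ip g g"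
    using ip_square_expand[of f g 1] assms by simp
  also have "\<dots> \<le> (ip_norm ip f + ip_norm ip g)\<^sup>2"
    using Cauchy_Schwarz[OF assms] ip_ge_zero assms by (simp add: power2_sum ip_norm_def)
  finally show ?thesis
    unfolding ip_norm_def[of _ "\<lambda>x. f x + g x"]
    by (rule real_le_lsqrt[rotated]) (simp_all add: ip_norm_def ip_ge_zero assms)
qed

lemma Metric_space_ip_dist: "Metric_space H (ip_dist H ip)"
proof
  fix f g
  show "0 \<le> ip_dist H ip f g"
    by (simp add: ip_dist_def ip_norm_def ip_ge_zero diff_mem)
  show "ip_dist H ip f g = ip_dist H ip g f"
  proof (cases "f \<in> H \<and> g \<in> H")
    case True
    define d where "d = (\<lambda>x. f x - g x)"
    have m: "d \<in> H" using True by (simp add: d_def diff_mem)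
    have "(\<lambda>x. g x - f x) = (\<lambda>x. (-1) * d x)" by (auto simp: d_def)
    moreover have "ip (\<lambda>x. (-1) * d x) (\<lambda>x. (-1) * d x) = ip d d"
      using ip_scale_left[OF m scale_mem[OF m, of "-1"], of "-1"]
        ip_scale_right[OF m m, of "-1"] by linarith
    ultimately have "ip (\<lambda>x. g x - f x) (\<lambda>x. g x - f x) = ip (\<lambda>x. f x - g x) (\<lambda>x. f x - g x)"
      by (simp only: d_def)
    then show ?thesis using True by (simp add: ip_dist_def ip_norm_def)
  qed (auto simp: ip_dist_def)
next
  fix f g assume fg: "f \<in> H" "g \<in> H"
  have dist: "ip_dist H ip f g = sqrt (ip (\<lambda>x. f x - g x) (\<lambda>x. f x - g x))"
    by (simp only: ip_dist_def ip_norm_def fg if_True simp_thms)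
  show "ip_dist H ip f g = 0 \<longleftrightarrow> f = g"
  proof
    assume "ip_dist H ip f g = 0"
    then have "(\<lambda>x. f x - g x) = (\<lambda>_. 0)"
      by (intro ip_eq_zero diff_mem fg) (simp only: dist real_sqrt_eq_0_iff)
    then show "f = g"
      by (intro ext) (metis eq_iff_diff_eq_0)
  next
    assume eq: "f = g"
    have "ip (\<lambda>_. 0) (\<lambda>_. 0) = 0"
      using ip_scale_left[OF zero_mem zero_mem, of 0] by (simp only: mult_zero_left)
    then show "ip_dist H ip f g = 0"
      unfolding dist unfolding eq by (simp only: diff_self real_sqrt_zero)
  qed
next
  fix f g h assume "f \<in> H" "g \<in> H" "h \<in> H"
  then show "ip_dist H ip f h \<le> ip_dist H ip f g + ip_dist H ip g h"
    using ip_norm_triangle[of "\<lambda>x. f x - g x" "\<lambda>x. g x - h x"]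
    by (simp add: ip_dist_def diff_mem)
qed

end

text \<open>
  \<open>rkhs k H ip\<close>: the function space \<open>H\<close> with inner product \<open>ip\<close> is the RKHS of the kernel \<open>k\<close>.
  By the Moore--Aronszajn theorem every kernel \<open>k\<close> has exactly one such \<open>H\<close>, and \<open>ip\<close> is
  unique on \<open>H\<close>; its values off \<open>H\<close> are irrelevant.
\<close>

locale rkhs = function_ip_space H ip
  for k :: "'a \<Rightarrow> 'a \<Rightarrow> real"
    and H :: "('a \<Rightarrow> real) set"
    and ip :: "('a \<Rightarrow> real) \<Rightarrow> ('a \<Rightarrow> real) \<Rightarrow> real" +
  assumes complete: "Metric_space.mcomplete H (ip_dist H ip)"
    and kernel_section_mem: "\<And>x. (\<lambda>x'. k x' x) \<in> H"
    and reproducing: "\<And>f x. f \<in> H \<Longrightarrow> f x = ip f (\<lambda>x'. k x' x)"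

definition separable_ip_space ::
  "('a \<Rightarrow> real) set \<Rightarrow> (('a \<Rightarrow> real) \<Rightarrow> ('a \<Rightarrow> real) \<Rightarrow> real) \<Rightarrow> bool" where
  "separable_ip_space H ip \<longleftrightarrow> separable_space (Metric_space.mtopology H (ip_dist H ip))"


section \<open>Loss functions and support vector machines\<close>

text \<open>
  The space \<open>\<X>\<close> is a type and \<open>\<Y>\<close> a set \<open>Y\<close> of reals; only the values \<open>L x y t\<close> with
  \<open>y \<in> Y\<close> matter.
\<close>

definition loss_function ::
  "real set \<Rightarrow> ('a::topological_space \<Rightarrow> real \<Rightarrow> real \<Rightarrow> real) \<Rightarrow> bool" where
  "loss_function Y L \<longleftrightarrow>
     (\<forall>x. \<forall>y\<in>Y. \<forall>t. 0 \<le> L x y t) \<and>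
     (\<lambda>(x, y, t). L x y t) \<in> borel_measurable (restrict_space borel (UNIV \<times> Y \<times> UNIV))"

definition convex_loss :: "real set \<Rightarrow> ('a \<Rightarrow> real \<Rightarrow> real \<Rightarrow> real) \<Rightarrow> bool" where
  "convex_loss Y L \<longleftrightarrow> (\<forall>x. \<forall>y\<in>Y. convex_on UNIV (L x y))"

definition lipschitz_loss_with :: "real set \<Rightarrow> ('a \<Rightarrow> real \<Rightarrow> real \<Rightarrow> real) \<Rightarrow> real \<Rightarrow> bool" where
  "lipschitz_loss_with Y L c \<longleftrightarrow> 0 \<le> c \<and> (\<forall>x. \<forall>y\<in>Y. c-lipschitz_on UNIV (L x y))"

definition lipschitz_loss :: "real set \<Rightarrow> ('a \<Rightarrow> real \<Rightarrow> real \<Rightarrow> real) \<Rightarrow> bool" where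
  "lipschitz_loss Y L \<longleftrightarrow> (\<exists>c. lipschitz_loss_with Y L c)"

definition lipschitz_const :: "real set \<Rightarrow> ('a \<Rightarrow> real \<Rightarrow> real \<Rightarrow> real) \<Rightarrow> real" where
  "lipschitz_const Y L = Inf {c. lipschitz_loss_with Y L c}"

definition shifted_loss :: "('a \<Rightarrow> real \<Rightarrow> real \<Rightarrow> real) \<Rightarrow> 'a \<Rightarrow> real \<Rightarrow> real \<Rightarrow> real" where
  "shifted_loss L x y t = L x y t - L x y 0"

definition borel_prob_on ::
  "real set \<Rightarrow> ('a::topological_space \<times> real) measure \<Rightarrow> bool" where
  "borel_prob_on Y P \<longleftrightarrow> prob_space P \<and> sets P = sets (restrict_space borel (UNIV \<times> Y))"

definition risk ::
  "('a \<Rightarrow> real \<Rightarrow> real \<Rightarrow> real) \<Rightarrow> ('a \<times> real) measure \<Rightarrow> ('a \<Rightarrow> real) \<Rightarrow> real" where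
  "risk L P f = (\<integral>z. shifted_loss L (fst z) (snd z) (f (fst z)) \<partial>P)"

definition svm ::
  "('a \<Rightarrow> real \<Rightarrow> real \<Rightarrow> real) \<Rightarrow> ('a \<times> real) measure \<Rightarrow> real \<Rightarrow>
    ('a \<Rightarrow> real) set \<Rightarrow> (('a \<Rightarrow> real) \<Rightarrow> ('a \<Rightarrow> real) \<Rightarrow> real) \<Rightarrow> 'a \<Rightarrow> real" where
  "svm L P lam H ip = arg_min_on (\<lambda>f. risk L P f + lam * (ip_norm ip f)\<^sup>2) H"


section \<open>Total variation norm\<close>

text \<open>
  \<open>\<nu>\<close> is a finite signed measure on the sigma-algebra of \<open>M\<close>, given by its values on \<open>sets M\<close>.
  That the classes of a partition in the sense of \<^const>\<open>partition_on\<close> are nonempty does not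
  affect the supremum.
\<close>

definition tv_norm :: "'b measure \<Rightarrow> ('b set \<Rightarrow> real) \<Rightarrow> real" where
  "tv_norm M \<nu> =
     Sup {\<Sum>E\<in>\<E>. \<bar>\<nu> E\<bar> | \<E>. finite \<E> \<and> \<E> \<subseteq> sets M \<and> partition_on (space M) \<E>}"

end

theory Submission
  imports Defs
begin

text \<open>
  Both SVMs are compared with the minimizer \<open>g\<close> for \<open>P2\<close>, \<open>lam2\<close> and \<open>k1\<close>. The quadratic growth of
  the regularized risk at its minimizer, applied to the two functionals on the common space \<open>H1\<close> and
  added up, bounds \<open>svm L P1 lam1 H1 ip1 - g\<close>.

  For the change of kernel, a loss with Lipschitz derivative \<open>h\<close> gives the representer formula
  \<open>2 * lam * ip f v = - E[h(f) * v]\<close>. Representing the gradient of the first minimizer \<open>f1\<close> in the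
  second space yields \<open>w \<in> H2\<close> with \<open>\<bar>f1 - w\<bar> \<le> c * D / (2 * lam)\<close>, where \<open>D\<close> bounds \<open>\<bar>k1 - k2\<bar>\<close>, and the
  monotonicity of \<open>h\<close> controls the norm of \<open>f2 - w\<close> in \<open>H2\<close>. A general loss is replaced by its averages over
  \<open>[t, t + e]\<close>; this avoids choosing a measurable subgradient.
\<close>

section \<open>Regularized minimization in Hilbert spaces of functions\<close>

text \<open>Let \<open>t\<close> tend to \<open>0\<close> from the right. This one form serves
  first-order optimality conditions, the mesh of a discretization and the removal of
  smoothing.\<close>

lemma nonneg_if_add_small_nonneg:
  fixes x y :: real
  assumes "\<And>t. 0 < t \<Longrightarrow> t < 1 \<Longrightarrow> 0 \<le> x + t * y"
  shows "0 \<le> x"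
proof -
  have "eventually (\<lambda>t. 0 \<le> x + t * y) (at_right 0)"
    using assms by (auto simp: eventually_at_right_field intro!: exI[of _ 1])
  moreover have "((\<lambda>t. x + t * y) \<longlongrightarrow> x + 0 * y) (at_right 0)"
    by (intro tendsto_intros)
  ultimately show ?thesis
    using tendsto_lowerbound[OF _ _ trivial_limit_at_right_real] by fastforce
qed

context function_ip_space
begin

lemma ip_zero_left: "f \<in> H \<Longrightarrow> ip (\<lambda>_. 0) f = 0"
  using ip_scale_left[of f f 0] by simp

lemma ip_diff_left:
  "f \<in> H \<Longrightarrow> g \<in> H \<Longrightarrow> h \<in> H \<Longrightarrow> ip (\<lambda>x. f x - g x) h = ip f h - ip g h"
  using ip_add_left[of f "\<lambda>x. (-1) * g x" h] ip_scale_left[of g h "-1"] scale_mem[of g "-1"]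
  by simp

lemma line_mem: "f \<in> H \<Longrightarrow> g \<in> H \<Longrightarrow> (\<lambda>x. f x + c * g x) \<in> H"
  by (simp add: add_mem scale_mem)

lemma ip_norm_ge_zero: "f \<in> H \<Longrightarrow> 0 \<le> ip_norm ip f"
  by (simp add: ip_norm_def ip_ge_zero)

lemma ip_norm_power2: "f \<in> H \<Longrightarrow> (ip_norm ip f)\<^sup>2 = ip f f"
  by (simp add: ip_norm_def ip_ge_zero)

lemma ip_norm_scale: "f \<in> H \<Longrightarrow> ip_norm ip (\<lambda>x. c * f x) = \<bar>c\<bar> * ip_norm ip f"
  using ip_scale_left[of f "\<lambda>x. c * f x" c] ip_scale_right[of f f c] scale_mem[of f c]
  by (simp add: ip_norm_def real_sqrt_mult flip: mult.assoc power2_eq_square)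

lemma ip_norm_minus_commute:
  "f \<in> H \<Longrightarrow> g \<in> H \<Longrightarrow> ip_norm ip (\<lambda>x. f x - g x) = ip_norm ip (\<lambda>x. g x - f x)"
  using ip_norm_scale[of "\<lambda>x. f x - g x" "-1"] diff_mem[of f g] by simp

lemma Cauchy_Schwarz_abs:
  assumes "f \<in> H" "g \<in> H"
  shows "\<bar>ip f g\<bar> \<le> ip_norm ip f * ip_norm ip g"
proof -
  have "- ip f g \<le> ip_norm ip f * ip_norm ip g"
    using Cauchy_Schwarz[of "\<lambda>x. (-1) * f x" g] ip_scale_left[of f g "-1"] scale_mem[of f "-1"]
      ip_norm_scale[of f "-1"] assms by simp
  then show ?thesis
    using Cauchy_Schwarz[OF assms] by linarith
qed

lemma ip_norm_triangle_diff:
  assumes "f \<in> H" "g \<in> H"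
  shows "\<bar>ip_norm ip f - ip_norm ip g\<bar> \<le> ip_norm ip (\<lambda>x. f x - g x)"
  using ip_norm_triangle[OF diff_mem[OF assms] assms(2)]
    ip_norm_triangle[OF diff_mem[OF assms(2,1)] assms(1)] ip_norm_minus_commute[OF assms]
  by simp

text \<open>First-order condition without differentiability of \<open>R\<close>: compare
  \<open>f\<close> with \<open>f + t * (g - f)\<close>, bound the change of \<open>R\<close> by
  convexity, expand the squared norm, divide by \<open>t\<close> and let \<open>t\<close> tend to
  \<open>0\<close>.\<close>

lemma regularized_minimizer_variational:
  assumes f: "f \<in> H" and g: "g \<in> H" and lam: "0 < lam"
    and convex: "\<And>t. 0 \<le> t \<Longrightarrow> t \<le> 1 \<Longrightarrow>
      R (\<lambda>x. f x + t * (g x - f x)) \<le> R f + t * (R g - R f)"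
    and min: "\<And>g. g \<in> H \<Longrightarrow> R f + lam * (ip_norm ip f)\<^sup>2 \<le> R g + lam * (ip_norm ip g)\<^sup>2"
  shows "0 \<le> R g - R f + 2 * lam * ip f (\<lambda>x. g x - f x)"
proof -
  let ?d = "\<lambda>x. g x - f x"
  have d: "?d \<in> H" by (rule diff_mem[OF g f])
  have "0 \<le> R g - R f + 2 * lam * ip f ?d + t * (lam * ip ?d ?d)" if t: "0 < t" "t < 1" for t
  proof -
    have "R f + lam * ip f f \<le> R f + t * (R g - R f) + lam * (ip f f + 2 * t * ip f ?d + t\<^sup>2 * ip ?d ?d)"
      using min[OF line_mem[OF f d, of t]] convex[of t] t
      by (simp add: ip_norm_power2 f line_mem[OF f d] ip_square_expand[OF f d])
    then have "0 \<le> t * (R g - R f + 2 * lam * ip f ?d + t * (lam * ip ?d ?d))"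
      by (simp add: algebra_simps power2_eq_square)
    then show ?thesis using t by (simp add: zero_le_mult_iff)
  qed
  then show ?thesis by (rule nonneg_if_add_small_nonneg)
qed

text \<open>Quadratic growth at the minimizer: the squared norm of \<open>g\<close> is expanded
  exactly around \<open>f\<close>, and the variational inequality absorbs the linear term.\<close>

lemma regularized_minimizer_gap:
  assumes f: "f \<in> H" and g: "g \<in> H" and lam: "0 < lam"
    and convex: "\<And>t. 0 \<le> t \<Longrightarrow> t \<le> 1 \<Longrightarrow>
      R (\<lambda>x. f x + t * (g x - f x)) \<le> R f + t * (R g - R f)"
    and min: "\<And>g. g \<in> H \<Longrightarrow> R f + lam * (ip_norm ip f)\<^sup>2 \<le> R g + lam * (ip_norm ip g)\<^sup>2"
  shows "R f + lam * (ip_norm ip f)\<^sup>2 + lam * (ip_norm ip (\<lambda>x. g x - f x))\<^sup>2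
    \<le> R g + lam * (ip_norm ip g)\<^sup>2"
proof -
  have "ip g g = ip f f + 2 * ip f (\<lambda>x. g x - f x) + ip (\<lambda>x. g x - f x) (\<lambda>x. g x - f x)"
    using ip_square_expand[OF f diff_mem[OF g f], of 1] by simp
  then show ?thesis
    using regularized_minimizer_variational[OF f g lam convex min]
    by (simp add: ip_norm_power2 f g diff_mem algebra_simps)
qed

end

text \<open>Completeness is phrased by sequences and \<open>ip_norm\<close>, so that it can be
  checked directly for a closed subspace as well as for an RKHS.\<close>

locale function_hilbert_space = function_ip_space +
  assumes seq_complete: "\<And>\<sigma>. (\<And>n. \<sigma> n \<in> H) \<Longrightarrow>
    (\<And>e. 0 < e \<Longrightarrow> \<exists>N. \<forall>m\<ge>N. \<forall>n\<ge>N. ip_norm ip (\<lambda>x. \<sigma> m x - \<sigma> n x) < e) \<Longrightarrow>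
    \<exists>f\<in>H. (\<lambda>n. ip_norm ip (\<lambda>x. \<sigma> n x - f x)) \<longlonglongrightarrow> 0"
begin

text \<open>Direct method: the Lipschitz bound makes the functional bounded below, strong convexity
  of the squared norm makes every minimizing sequence Cauchy, and continuity shows that its limit is
  a minimizer.\<close>

lemma regularized_minimizer_exists:
  assumes lam: "0 < lam"
    and convex: "\<And>f g t. f \<in> H \<Longrightarrow> g \<in> H \<Longrightarrow> 0 \<le> t \<Longrightarrow> t \<le> 1 \<Longrightarrow>
      R (\<lambda>x. f x + t * (g x - f x)) \<le> R f + t * (R g - R f)"
    and lipschitz: "\<And>f g. f \<in> H \<Longrightarrow> g \<in> H \<Longrightarrow> \<bar>R f - R g\<bar> \<le> C * ip_norm ip (\<lambda>x. f x - g x)"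
  shows "\<exists>f\<in>H. \<forall>g\<in>H. R f + lam * (ip_norm ip f)\<^sup>2 \<le> R g + lam * (ip_norm ip g)\<^sup>2"
proof -
  define J where "J = (\<lambda>f. R f + lam * (ip_norm ip f)\<^sup>2)"
  define m where "m = Inf (J ` H)"
  \<comment> \<open>The penalty beats the linear decrease of \<open>R\<close>; the worst case is
    norm \<open>C / (2 * lam)\<close>, found by completing the square.\<close>
  have "R (\<lambda>_. 0) - C\<^sup>2 / (4 * lam) \<le> J f" if f: "f \<in> H" for f
  proof -
    have "0 \<le> lam * (ip_norm ip f - C / (2 * lam))\<^sup>2"
      using lam by simp
    also have "\<dots> = lam * (ip_norm ip f)\<^sup>2 - C * ip_norm ip f + C\<^sup>2 / (4 * lam)"
      using lam by (simp add: power2_eq_square field_simps)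
    finally show ?thesis
      using lipschitz[OF f zero_mem] by (simp add: J_def)
  qed
  then have bdd: "bdd_below (J ` H)" by (intro bdd_belowI2)
  have m_le: "m \<le> J f" if "f \<in> H" for f
    unfolding m_def using that bdd by (rule cINF_lower[rotated])
  have ex: "\<exists>f\<in>H. J f < m + 1 / real (Suc n)" for n
    using cInf_lessD[of "J ` H" "m + 1 / real (Suc n)"] zero_mem by (auto simp: m_def)
  obtain \<sigma> where \<sigma>: "\<And>n. \<sigma> n \<in> H" "\<And>n. J (\<sigma> n) < m + 1 / real (Suc n)"
    using ex by metis
  \<comment> \<open>The midpoint of \<open>f\<close> and \<open>g\<close> still has value at least
    \<open>m\<close>, so the parallelogram identity bounds their distance by their excesses over
    \<open>m\<close>.\<close>
  have mid: "lam / 2 * (ip_norm ip (\<lambda>x. g x - f x))\<^sup>2 \<le> (J f - m) + (J g - m)"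
    if f: "f \<in> H" and g: "g \<in> H" for f g
  proof -
    let ?d = "\<lambda>x. g x - f x"
    have d: "?d \<in> H" by (rule diff_mem[OF g f])
    have "m \<le> J (\<lambda>x. f x + (1/2) * ?d x)"
      by (rule m_le[OF line_mem[OF f d]])
    also have "\<dots> \<le> R f + (1/2) * (R g - R f) + lam * (ip f f + ip f ?d + ip ?d ?d / 4)"
      using convex[OF f g, of "1/2"] ip_norm_power2[OF line_mem[OF f d, of "1/2"]]
        ip_square_expand[OF f d, of "1/2"]
      by (simp add: J_def power2_eq_square)
    finally have "2 * m \<le> R f + R g + lam * (2 * ip f f + 2 * ip f ?d + ip ?d ?d / 2)"
      by argo
    moreover have "ip g g = ip f f + 2 * ip f ?d + ip ?d ?d"
      using ip_square_expand[OF f d, of 1] by simp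
    ultimately show ?thesis
      by (simp add: J_def ip_norm_power2 f g d algebra_simps)
  qed
  have "\<exists>N. \<forall>m\<ge>N. \<forall>n\<ge>N. ip_norm ip (\<lambda>x. \<sigma> m x - \<sigma> n x) < e" if e: "0 < e" for e
  proof -
    \<comment> \<open>Two excesses below \<open>lam / 4 * e\<^sup>2\<close> add up to the
      \<open>lam / 2 * e\<^sup>2\<close> that \<open>mid\<close> needs.\<close>
    have "0 < lam / 4 * e\<^sup>2" using lam e by simp
    then obtain N where N: "1 / real (Suc N) < lam / 4 * e\<^sup>2"
      using nat_approx_posE by metis
    have "ip_norm ip (\<lambda>x. \<sigma> p x - \<sigma> q x) < e" if pq: "N \<le> p" "N \<le> q" for p q
    proof -
      have "1 / real (Suc p) \<le> 1 / real (Suc N)" "1 / real (Suc q) \<le> 1 / real (Suc N)"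
        using pq by (auto simp: frac_le)
      then have "lam / 2 * (ip_norm ip (\<lambda>x. \<sigma> p x - \<sigma> q x))\<^sup>2 < lam / 2 * e\<^sup>2"
        using mid[OF \<sigma>(1)[of q] \<sigma>(1)[of p]] \<sigma>(2)[of p] \<sigma>(2)[of q] N by linarith
      then have "(ip_norm ip (\<lambda>x. \<sigma> p x - \<sigma> q x))\<^sup>2 < e\<^sup>2"
        using lam by simp
      then show ?thesis using e by (simp add: power2_less_imp_less)
    qed
    then show ?thesis by blast
  qed
  then obtain f where f: "f \<in> H" and lim: "(\<lambda>n. ip_norm ip (\<lambda>x. \<sigma> n x - f x)) \<longlonglongrightarrow> 0"
    using seq_complete[of \<sigma>] \<sigma>(1) by blast
  have "(\<lambda>n. R (\<sigma> n)) \<longlonglongrightarrow> R f"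
  proof (rule LIM_zero_cancel, rule Lim_null_comparison)
    show "(\<lambda>n. C * ip_norm ip (\<lambda>x. \<sigma> n x - f x)) \<longlonglongrightarrow> 0"
      using tendsto_mult_left[OF lim, of C] by simp
  qed (simp add: lipschitz \<sigma>(1) f)
  moreover have "(\<lambda>n. ip_norm ip (\<sigma> n)) \<longlonglongrightarrow> ip_norm ip f"
    by (rule LIM_zero_cancel, rule Lim_null_comparison[OF _ lim])
      (simp add: ip_norm_triangle_diff \<sigma>(1) f)
  ultimately have "(\<lambda>n. J (\<sigma> n)) \<longlonglongrightarrow> J f"
    unfolding J_def by (intro tendsto_intros)
  moreover have "(\<lambda>n. m + 1 / real (Suc n)) \<longlonglongrightarrow> m + 0"
    by (intro tendsto_intros LIMSEQ_Suc[OF lim_1_over_n])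
  ultimately have "J f \<le> m + 0"
    by (rule LIMSEQ_le) (use \<sigma>(2) in \<open>auto intro: less_imp_le\<close>)
  then show ?thesis
    using f m_le unfolding J_def by force
qed

text \<open>The representing element minimizes the squared norm minus \<open>2 * l\<close>, which
  exists by the previous lemma with \<open>lam = 1\<close>; its first-order condition is the
  representation.\<close>

lemma Riesz_representation:
  assumes add: "\<And>f g. f \<in> H \<Longrightarrow> g \<in> H \<Longrightarrow> l (\<lambda>x. f x + g x) = l f + l g"
    and scale: "\<And>c f. f \<in> H \<Longrightarrow> l (\<lambda>x. c * f x) = c * l f"
    and bounded: "\<And>f. f \<in> H \<Longrightarrow> \<bar>l f\<bar> \<le> C * ip_norm ip f"
  shows "\<exists>g\<in>H. \<forall>f\<in>H. ip g f = l f"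
proof -
  have diff: "l (\<lambda>x. f x - g x) = l f - l g" if "f \<in> H" "g \<in> H" for f g
    using add[of f "\<lambda>x. (-1) * g x"] scale[of g "-1"] scale_mem[of g "-1"] that by simp
  have line: "l (\<lambda>x. f x + t * (g x - f x)) = l f + t * (l g - l f)" if "f \<in> H" "g \<in> H" for f g t
    using add[of f "\<lambda>x. t * (g x - f x)"] scale[of "\<lambda>x. g x - f x" t] diff[of g f] diff_mem scale_mem that
    by simp
  have line2: "- 2 * l (\<lambda>x. f x + t * (g x - f x)) \<le> - 2 * l f + t * (- 2 * l g - - 2 * l f)"
    if "f \<in> H" "g \<in> H" for f g t
    by (simp only: line[OF that]) (simp add: algebra_simps)
  have "\<exists>g\<in>H. \<forall>f\<in>H. - 2 * l g + 1 * (ip_norm ip g)\<^sup>2 \<le> - 2 * l f + 1 * (ip_norm ip f)\<^sup>2"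
  proof (rule regularized_minimizer_exists[where C = "2 * C"])
    fix f g assume fg: "f \<in> H" "g \<in> H"
    show "\<bar>- 2 * l f - - 2 * l g\<bar> \<le> 2 * C * ip_norm ip (\<lambda>x. f x - g x)"
      using bounded[OF diff_mem[OF fg]] diff[OF fg] by (simp add: abs_le_iff)
  qed (use line2 in simp_all)
  then obtain g where g: "g \<in> H"
    and min: "\<And>f. f \<in> H \<Longrightarrow> - 2 * l g + 1 * (ip_norm ip g)\<^sup>2 \<le> - 2 * l f + 1 * (ip_norm ip f)\<^sup>2"
    by blast
  \<comment> \<open>The variational inequality is tested at \<open>g + f\<close>; replacing
    \<open>f\<close> by its negative afterwards gives the opposite inequality.\<close>
  have ge: "l f \<le> ip g f" if f: "f \<in> H" for f
    using regularized_minimizer_variational[where R = "\<lambda>f. - 2 * l f" and lam = 1,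
        OF g add_mem[OF g f] _ line2[OF g add_mem[OF g f]] min]
      add[OF g f] by simp
  have "ip g f = l f" if f: "f \<in> H" for f
    using ge[OF f] ge[OF scale_mem[OF f, of "-1"]] scale[OF f, of "-1"] ip_scale_right[OF f g, of "-1"]
    by simp
  then show ?thesis using g by blast
qed

end

sublocale rkhs \<subseteq> function_hilbert_space
proof
  fix \<sigma> :: "nat \<Rightarrow> 'a \<Rightarrow> real"
  interpret MS: Metric_space H "ip_dist H ip"
    by (rule Metric_space_ip_dist)
  assume \<sigma>: "\<And>n. \<sigma> n \<in> H"
    and Cauchy: "\<And>e. 0 < e \<Longrightarrow> \<exists>N. \<forall>m\<ge>N. \<forall>n\<ge>N. ip_norm ip (\<lambda>x. \<sigma> m x - \<sigma> n x) < e"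
  have dist: "ip_dist H ip f g = ip_norm ip (\<lambda>x. f x - g x)" if "f \<in> H" "g \<in> H" for f g
    using that by (simp add: ip_dist_def)
  have "MS.MCauchy \<sigma>"
    unfolding MS.MCauchy_def using \<sigma> Cauchy by (auto simp: dist)
  then obtain f where "limitin MS.mtopology \<sigma> f sequentially"
    using complete unfolding MS.mcomplete_def by blast
  then have f: "f \<in> H" and ev: "\<And>e. 0 < e \<Longrightarrow> \<forall>\<^sub>F n in sequentially. \<sigma> n \<in> H \<and> ip_dist H ip (\<sigma> n) f < e"
    unfolding MS.limitin_metric by auto
  have "(\<lambda>n. ip_norm ip (\<lambda>x. \<sigma> n x - f x)) \<longlonglongrightarrow> 0"
  proof (rule tendstoI)
    fix e :: real assume "0 < e"
    from ev[OF this] show "\<forall>\<^sub>F n in sequentially. dist (ip_norm ip (\<lambda>x. \<sigma> n x - f x)) 0 < e"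
      by eventually_elim (simp add: dist f \<sigma> ip_norm_ge_zero diff_mem)
  qed
  then show "\<exists>f\<in>H. (\<lambda>n. ip_norm ip (\<lambda>x. \<sigma> n x - f x)) \<longlonglongrightarrow> 0"
    using f by blast
qed

section \<open>Bounded measurable kernels\<close>

text \<open>The number \<open>\<kappa>\<close> is any upper bound rather than the supremum itself,
  so that two kernels can share it.\<close>

locale bounded_rkhs = rkhs k H ip
  for k :: "'a::topological_space \<Rightarrow> 'a \<Rightarrow> real" and H ip +
  fixes \<kappa> :: real
  assumes kernel_diag: "\<And>x. sqrt (k x x) \<le> \<kappa>"
    and kernel_section_measurable: "\<And>x. (\<lambda>x'. k x' x) \<in> borel_measurable borel"
begin

lemma ip_norm_kernel_section: "ip_norm ip (\<lambda>x'. k x' x) = sqrt (k x x)"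
  unfolding ip_norm_def using reproducing[OF kernel_section_mem, of x x] by simp

lemma kappa_ge_zero: "0 \<le> \<kappa>"
  using kernel_diag ip_norm_kernel_section ip_norm_ge_zero[OF kernel_section_mem] by (metis order_trans)

text \<open>Reproducing property and Cauchy-Schwarz. Every pointwise estimate obtained from a norm
  estimate in \<open>H\<close> passes through this inequality.\<close>

lemma abs_le_ip_norm:
  assumes f: "f \<in> H"
  shows "\<bar>f x\<bar> \<le> \<kappa> * ip_norm ip f"
proof -
  have "\<bar>f x\<bar> \<le> ip_norm ip f * sqrt (k x x)"
    using Cauchy_Schwarz_abs[OF f kernel_section_mem, of x] reproducing[OF f, of x]
    by (simp add: ip_norm_kernel_section)
  also have "\<dots> \<le> ip_norm ip f * \<kappa>"
    by (rule mult_left_mono[OF kernel_diag ip_norm_ge_zero[OF f]])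
  finally show ?thesis by (simp add: mult.commute)
qed

lemma abs_kernel_le: "\<bar>k x x'\<bar> \<le> \<kappa>\<^sup>2"
proof -
  have "\<bar>k x x'\<bar> \<le> \<kappa> * sqrt (k x' x')"
    using abs_le_ip_norm[OF kernel_section_mem] ip_norm_kernel_section by simp
  also have "\<dots> \<le> \<kappa> * \<kappa>" by (rule mult_left_mono[OF kernel_diag kappa_ge_zero])
  finally show ?thesis by (simp add: power2_eq_square)
qed

text \<open>
  The measurable elements form a closed subspace that contains all kernel sections; by the
  Riesz representation an element of \<open>H\<close> agrees with its projection to this subspace.
\<close>

lemma measurable_mem:
  assumes f: "f \<in> H"
  shows "f \<in> borel_measurable borel"
proof -
  let ?H = "H \<inter> borel_measurable borel"
  interpret S: function_hilbert_space ?H ip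
  proof
    show "(\<lambda>_. 0) \<in> ?H" using zero_mem by simp
    show "\<And>f g. f \<in> ?H \<Longrightarrow> g \<in> ?H \<Longrightarrow> (\<lambda>x. f x + g x) \<in> ?H"
      by (auto intro: add_mem borel_measurable_add)
    show "\<And>c f. f \<in> ?H \<Longrightarrow> (\<lambda>x. c * f x) \<in> ?H"
      by (auto intro!: scale_mem borel_measurable_times borel_measurable_const)
    fix \<sigma> :: "nat \<Rightarrow> 'a \<Rightarrow> real"
    assume \<sigma>: "\<And>n. \<sigma> n \<in> ?H"
      and "\<And>e. 0 < e \<Longrightarrow> \<exists>N. \<forall>m\<ge>N. \<forall>n\<ge>N. ip_norm ip (\<lambda>x. \<sigma> m x - \<sigma> n x) < e"
    then obtain g where g: "g \<in> H" and lim: "(\<lambda>n. ip_norm ip (\<lambda>x. \<sigma> n x - g x)) \<longlonglongrightarrow> 0"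
      using seq_complete[of \<sigma>] by blast
    \<comment> \<open>Convergence in the norm of \<open>H\<close> forces pointwise convergence, and
      pointwise limits keep measurability; hence the subspace is closed.\<close>
    have "(\<lambda>n. \<sigma> n x) \<longlonglongrightarrow> g x" for x
    proof (rule LIM_zero_cancel, rule Lim_null_comparison)
      show "(\<lambda>n. \<kappa> * ip_norm ip (\<lambda>x. \<sigma> n x - g x)) \<longlonglongrightarrow> 0"
        using tendsto_mult_left[OF lim, of \<kappa>] by simp
      show "\<forall>\<^sub>F n in sequentially. norm (\<sigma> n x - g x) \<le> \<kappa> * ip_norm ip (\<lambda>x. \<sigma> n x - g x)"
        using abs_le_ip_norm[OF diff_mem[OF _ g]] \<sigma> by simp
    qed
    then have "g \<in> borel_measurable borel"
      using borel_measurable_LIMSEQ_real[of borel \<sigma> g] \<sigma> by simp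
    then show "\<exists>f\<in>?H. (\<lambda>n. ip_norm ip (\<lambda>x. \<sigma> n x - f x)) \<longlonglongrightarrow> 0"
      using g lim by blast
  qed (simp_all add: ip_commute ip_add_left ip_scale_left ip_ge_zero ip_eq_zero)
  have "\<exists>g\<in>?H. \<forall>v\<in>?H. ip g v = ip f v"
    by (rule S.Riesz_representation[where C = "ip_norm ip f"])
      (simp_all add: f ip_add_right ip_scale_right Cauchy_Schwarz_abs)
  then obtain g where g: "g \<in> ?H" and eq: "\<And>v. v \<in> ?H \<Longrightarrow> ip g v = ip f v" by blast
  have "f = g"
  proof
    fix x
    show "f x = g x"
      using eq[of "\<lambda>x'. k x' x"] reproducing[of f x] reproducing[of g x] f g
        kernel_section_mem kernel_section_measurable by simp
  qed
  then show ?thesis using g by simp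
qed

end

section \<open>Total variation and integrals of bounded functions\<close>

lemma (in prob_space) abs_integral_le_const:
  fixes f :: "'a \<Rightarrow> real"
  assumes "integrable M f" "\<And>z. z \<in> space M \<Longrightarrow> \<bar>f z\<bar> \<le> B"
  shows "\<bar>\<integral>z. f z \<partial>M\<bar> \<le> B"
proof -
  have "(\<integral>z. \<bar>f z\<bar> \<partial>M) \<le> B"
    using assms by (intro integral_le_const integrable_abs AE_I2)
  then show ?thesis
    using integral_abs_bound[of M f] by linarith
qed

text \<open>The supremum over partitions is a genuine upper bound because every such sum is at most
  \<open>2\<close>, the total mass of \<open>P\<close> and \<open>Q\<close> together.\<close>

lemma sum_abs_measure_diff_le_tv_norm:
  assumes "prob_space P" "prob_space Q" and sets: "sets Q = sets P"
    and \<E>: "finite \<E>" "\<E> \<subseteq> sets P" "partition_on (space P) \<E>"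
  shows "(\<Sum>E\<in>\<E>. \<bar>measure P E - measure Q E\<bar>) \<le> tv_norm P (\<lambda>E. measure P E - measure Q E)"
proof -
  interpret P: prob_space P by fact
  interpret Q: prob_space Q by fact
  have space: "space Q = space P" using sets by (rule sets_eq_imp_space_eq)
  have "(\<Sum>E\<in>\<F>. \<bar>measure P E - measure Q E\<bar>) \<le> 2"
    if \<F>: "finite \<F>" "\<F> \<subseteq> sets P" "partition_on (space P) \<F>" for \<F>
  proof -
    have disj: "disjoint_family_on (\<lambda>E. E) \<F>" and un: "(\<Union>E\<in>\<F>. E) = space P"
      using \<F>(3) by (auto simp: partition_on_def disjoint_family_on_def pairwise_def disjnt_def)
    have "(\<Sum>E\<in>\<F>. \<bar>measure P E - measure Q E\<bar>) \<le> (\<Sum>E\<in>\<F>. measure P E + measure Q E)"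
      by (intro sum_mono) (simp add: abs_le_iff add_increasing add_increasing2)
    also have "\<dots> = measure P (\<Union>E\<in>\<F>. E) + measure Q (\<Union>E\<in>\<F>. E)"
      using \<F>(1,2) disj sets P.finite_measure_finite_Union[of \<F> "\<lambda>E. E"]
        Q.finite_measure_finite_Union[of \<F> "\<lambda>E. E"]
      by (simp add: sum.distrib)
    also have "\<dots> = 2"
      unfolding un using P.prob_space Q.prob_space space by simp
    finally show ?thesis .
  qed
  then show ?thesis
    unfolding tv_norm_def using \<E> by (intro cSup_upper bdd_aboveI[of _ 2]) auto
qed

text \<open>Round \<open>h\<close> down to multiples of \<open>d\<close>. The level sets form a
  finite partition, on which the integrals are compared by total variation; then \<open>d\<close>
  tends to \<open>0\<close>.\<close>

lemma abs_integral_diff_le_tv_norm: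
  assumes P: "prob_space P" and Q: "prob_space Q" and sets: "sets Q = sets P"
    and h [measurable]: "h \<in> borel_measurable P"
    and bound: "\<And>z. z \<in> space P \<Longrightarrow> \<bar>h z\<bar> \<le> B"
  shows "\<bar>(\<integral>z. h z \<partial>P) - (\<integral>z. h z \<partial>Q)\<bar> \<le> B * tv_norm P (\<lambda>E. measure P E - measure Q E)"
    (is "?I \<le> B * ?tv")
proof -
  interpret P: prob_space P by fact
  interpret Q: prob_space Q by fact
  have space: "space Q = space P" using sets by (rule sets_eq_imp_space_eq)
  \<comment> \<open>The rounding error \<open>d\<close> occurs once for each measure, and the
    rounded values are bounded only by \<open>B + d\<close>.\<close>
  have approx: "?I \<le> B * ?tv + d * (2 + ?tv)" if d: "0 < d" for d
  proof -
    define e where "e = (\<lambda>z. \<lfloor>h z / d\<rfloor>)"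
    define E where "E = (\<lambda>j. e -` {j} \<inter> space P)"
    define J where "J = e ` space P"
    have e_meas [measurable]: "e \<in> measurable P (count_space UNIV)"
      unfolding e_def by measurable
    have E_sets [measurable]: "E j \<in> sets P" for j
      unfolding E_def by measurable
    \<comment> \<open>Boundedness of \<open>h\<close> leaves only finitely many levels.\<close>
    have "J \<subseteq> {\<lfloor>- B / d\<rfloor>..\<lfloor>B / d\<rfloor>}"
    proof
      fix j assume "j \<in> J"
      then obtain z where z: "z \<in> space P" "j = e z" by (auto simp: J_def)
      have "- B / d \<le> h z / d" "h z / d \<le> B / d"
        using bound[OF z(1)] d by (intro divide_right_mono; simp add: abs_le_iff)+
      then show "j \<in> {\<lfloor>- B / d\<rfloor>..\<lfloor>B / d\<rfloor>}"
        unfolding z(2) e_def by (simp add: floor_mono del: minus_divide_left)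
    qed
    then have J: "finite J" by (rule finite_subset) simp
    have part: "partition_on (space P) (E ` J)"
      by (auto simp: E_def J_def disjnt_def intro!: partition_onI)
    have inj: "inj_on E J"
      by (auto simp: inj_on_def E_def J_def)
    \<comment> \<open>Stated for a general \<open>R\<close> in order to be used with both
      \<open>P\<close> and \<open>Q\<close>.\<close>
    have close: "\<bar>(\<integral>z. h z \<partial>R) - (\<Sum>j\<in>J. d * j * measure R (E j))\<bar> \<le> d"
      if R: "prob_space R" "sets R = sets P" for R
    proof -
      interpret R: prob_space R by fact
      have sp: "space R = space P" using R(2) by (rule sets_eq_imp_space_eq)
      have hR: "h \<in> borel_measurable R" using h R(2) by (simp cong: measurable_cong_sets)
      have ER: "E j \<in> sets R" for j using E_sets R(2) by simp
      have int_h: "integrable R h"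
        by (rule R.integrable_const_bound[of _ B]) (auto simp: bound sp hR)
      let ?s = "\<lambda>z. \<Sum>j\<in>J. d * j * indicator (E j) z"
      have int_s: "integrable R ?s"
        using ER by (intro Bochner_Integration.integrable_sum integrable_mult_right integrable_real_indicator)
          (auto simp: R.emeasure_eq_measure)
      have s: "?s z = d * e z" if "z \<in> space P" for z
      proof -
        have "?s z = (\<Sum>j\<in>J. if j = e z then d * j else 0)"
          using that by (intro sum.cong) (auto simp: E_def)
        then show ?thesis using J that by (simp add: J_def)
      qed
      have "\<bar>h z - ?s z\<bar> \<le> d" if z: "z \<in> space P" for z
      proof -
        have "d * e z \<le> h z" "h z \<le> d * (e z + 1)"
          unfolding e_def using floor_divide_lower[OF d, of "h z"] floor_divide_upper[OF d, of "h z"]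
          by (simp_all add: mult.commute)
        then show ?thesis using s[OF z] by (simp add: algebra_simps)
      qed
      then have "\<bar>\<integral>z. h z - ?s z \<partial>R\<bar> \<le> d"
        by (intro R.abs_integral_le_const Bochner_Integration.integrable_diff int_h int_s)
          (simp add: sp)
      moreover have "(\<integral>z. ?s z \<partial>R) = (\<Sum>j\<in>J. d * j * measure R (E j))"
        using ER by (subst Bochner_Integration.integral_sum)
          (auto simp: R.emeasure_eq_measure sp E_def intro!: sum.cong)
      ultimately show ?thesis
        using int_h int_s by simp
    qed
    have dj: "\<bar>d * j\<bar> \<le> B + d" if j: "j \<in> J" for j
    proof -
      obtain z where z: "z \<in> space P" "j = e z" using j by (auto simp: J_def)
      have "d * e z \<le> h z" "h z \<le> d * (e z + 1)"
        unfolding e_def using floor_divide_lower[OF d, of "h z"] floor_divide_upper[OF d, of "h z"]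
        by (simp_all add: mult.commute)
      then show ?thesis using bound[OF z(1)] d unfolding z(2) by (simp add: abs_le_iff algebra_simps)
    qed
    obtain z where "z \<in> space P" using P.not_empty by auto
    then have "0 \<le> B + d" using bound[of z] d by linarith
    have "\<bar>(\<Sum>j\<in>J. d * j * measure P (E j)) - (\<Sum>j\<in>J. d * j * measure Q (E j))\<bar>
        = \<bar>\<Sum>j\<in>J. d * j * (measure P (E j) - measure Q (E j))\<bar>"
      by (simp add: sum_subtractf right_diff_distrib)
    also have "\<dots> \<le> (\<Sum>j\<in>J. (B + d) * \<bar>measure P (E j) - measure Q (E j)\<bar>)"
      using dj by (intro order_trans[OF sum_abs] sum_mono)
        (simp only: abs_mult[of "d * _"] mult_right_mono[OF _ abs_ge_zero])
    also have "\<dots> = (B + d) * (\<Sum>F\<in>E ` J. \<bar>measure P F - measure Q F\<bar>)"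
      by (simp add: sum.reindex[OF inj] sum_distrib_left)
    also have "\<dots> \<le> (B + d) * ?tv"
      using J E_sets part \<open>0 \<le> B + d\<close>
      by (intro mult_left_mono sum_abs_measure_diff_le_tv_norm[OF P Q sets]) auto
    finally show ?thesis
      using close[OF P refl] close[OF Q sets] by (simp add: algebra_simps abs_le_iff)
  qed
  have "0 \<le> B * ?tv - ?I + t * (2 + ?tv)" if "0 < t" for t
    using approx[OF that] by linarith
  then have "0 \<le> B * ?tv - ?I"
    by (rule nonneg_if_add_small_nonneg)
  then show ?thesis by simp
qed

lemma tv_norm_ge_zero:
  assumes "prob_space P" "prob_space Q" "sets Q = sets P"
  shows "0 \<le> tv_norm P (\<lambda>E. measure P E - measure Q E)"
  using abs_integral_diff_le_tv_norm[OF assms, of "\<lambda>_. 0" 1] by simp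

section \<open>Regularized risk minimization\<close>

text \<open>The loss takes the pair \<open>z\<close> as one argument, so that the shifted loss and
  its smooth approximations are treated alike.\<close>

definition loss_integral :: "('a \<times> real) measure \<Rightarrow> ('a \<times> real \<Rightarrow> real \<Rightarrow> real) \<Rightarrow> ('a \<Rightarrow> real) \<Rightarrow> real" where
  "loss_integral M l f = (\<integral>z. l z (f (fst z)) \<partial>M)"

definition regularized_minimizer ::
  "('a \<times> real) measure \<Rightarrow> ('a \<times> real \<Rightarrow> real \<Rightarrow> real) \<Rightarrow> real \<Rightarrow> ('a \<Rightarrow> real) set \<Rightarrow>
    (('a \<Rightarrow> real) \<Rightarrow> ('a \<Rightarrow> real) \<Rightarrow> real) \<Rightarrow> ('a \<Rightarrow> real) \<Rightarrow> bool" where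
  "regularized_minimizer M l lam H ip f \<longleftrightarrow> f \<in> H \<and>
     (\<forall>g\<in>H. loss_integral M l f + lam * (ip_norm ip f)\<^sup>2 \<le> loss_integral M l g + lam * (ip_norm ip g)\<^sup>2)"

lemma measurable_uncurry_compose:
  assumes "case_prod h \<in> borel_measurable (M \<Otimes>\<^sub>M N)" "g \<in> measurable M N"
  shows "(\<lambda>z. h z (g z)) \<in> borel_measurable M"
  using measurable_compose[OF measurable_Pair[OF measurable_ident assms(2)] assms(1)] by simp

text \<open>The normalization \<open>loss_zero\<close> is what the shift provides: with the
  Lipschitz bound it dominates the loss by a multiple of the prediction. The pointwise conditions
  are restricted to \<open>space M\<close>, which encodes that labels lie in
  \<open>Y\<close>.\<close>

locale convex_lipschitz_loss = prob_space M
  for M :: "('a::topological_space \<times> real) measure" +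
  fixes l :: "'a \<times> real \<Rightarrow> real \<Rightarrow> real" and c :: real
  assumes fst_measurable: "fst \<in> borel_measurable M"
    and loss_measurable: "case_prod l \<in> borel_measurable (M \<Otimes>\<^sub>M borel)"
    and const_ge_zero: "0 \<le> c"
    and loss_zero: "\<And>z. z \<in> space M \<Longrightarrow> l z 0 = 0"
    and loss_lipschitz: "\<And>z a b. z \<in> space M \<Longrightarrow> \<bar>l z a - l z b\<bar> \<le> c * \<bar>a - b\<bar>"
    and loss_convex: "\<And>z a b t. z \<in> space M \<Longrightarrow> 0 \<le> t \<Longrightarrow> t \<le> 1 \<Longrightarrow>
      l z (a + t * (b - a)) \<le> l z a + t * (l z b - l z a)"

locale regularized_risk = bounded_rkhs k H ip \<kappa> + convex_lipschitz_loss M l c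
  for k :: "'a::topological_space \<Rightarrow> 'a \<Rightarrow> real" and H ip \<kappa>
    and M :: "('a \<times> real) measure" and l c
begin

lemma mem_fst_measurable:
  "f \<in> H \<Longrightarrow> (\<lambda>z. f (fst z)) \<in> borel_measurable M"
  using measurable_compose[OF fst_measurable measurable_mem] .

lemma loss_integrable:
  assumes f: "f \<in> H"
  shows "integrable M (\<lambda>z. l z (f (fst z)))"
proof (rule integrable_const_bound[of _ "c * (\<kappa> * ip_norm ip f)"])
  have "\<bar>l z (f (fst z))\<bar> \<le> c * (\<kappa> * ip_norm ip f)" if z: "z \<in> space M" for z
    using loss_lipschitz[OF z, of "f (fst z)" 0] loss_zero[OF z]
      mult_left_mono[OF abs_le_ip_norm[OF f, of "fst z"] const_ge_zero] by simp
  then show "AE z in M. norm (l z (f (fst z))) \<le> c * (\<kappa> * ip_norm ip f)"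
    by (auto intro!: AE_I2)
  show "(\<lambda>z. l z (f (fst z))) \<in> borel_measurable M"
    by (rule measurable_uncurry_compose[OF loss_measurable mem_fst_measurable[OF f]])
qed

lemma loss_diff_le:
  assumes f: "f \<in> H" and g: "g \<in> H" and z: "z \<in> space M"
  shows "\<bar>l z (f (fst z)) - l z (g (fst z))\<bar> \<le> c * \<kappa> * ip_norm ip (\<lambda>x. f x - g x)"
  using loss_lipschitz[OF z, of "f (fst z)" "g (fst z)"]
    mult_left_mono[OF abs_le_ip_norm[OF diff_mem[OF f g], of "fst z"] const_ge_zero]
  by (simp add: mult.assoc)

lemma loss_integral_lipschitz:
  assumes f: "f \<in> H" and g: "g \<in> H"
  shows "\<bar>loss_integral M l f - loss_integral M l g\<bar> \<le> c * \<kappa> * ip_norm ip (\<lambda>x. f x - g x)"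
proof -
  have "\<bar>\<integral>z. l z (f (fst z)) - l z (g (fst z)) \<partial>M\<bar> \<le> c * \<kappa> * ip_norm ip (\<lambda>x. f x - g x)"
    using loss_diff_le[OF f g] loss_integrable[OF f] loss_integrable[OF g]
    by (intro abs_integral_le_const) auto
  then show ?thesis
    by (simp add: loss_integral_def loss_integrable f g)
qed

lemma loss_integral_zero: "loss_integral M l (\<lambda>_. 0) = 0"
  unfolding loss_integral_def
  by (subst Bochner_Integration.integral_cong[OF refl, of _ _ "\<lambda>_. 0"]) (auto simp: loss_zero)

lemma loss_integral_convex:
  assumes f: "f \<in> H" and g: "g \<in> H" and t: "0 \<le> t" "t \<le> 1"
  shows "loss_integral M l (\<lambda>x. f x + t * (g x - f x))
    \<le> loss_integral M l f + t * (loss_integral M l g - loss_integral M l f)"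
proof -
  have "loss_integral M l (\<lambda>x. f x + t * (g x - f x))
      \<le> (\<integral>z. l z (f (fst z)) + t * (l z (g (fst z)) - l z (f (fst z))) \<partial>M)"
    unfolding loss_integral_def
    using loss_integrable[OF line_mem[OF f diff_mem[OF g f], of t]] loss_integrable[OF f]
      loss_integrable[OF g] loss_convex t
    by (intro Bochner_Integration.integral_mono) auto
  also have "\<dots> = loss_integral M l f + t * (loss_integral M l g - loss_integral M l f)"
    using loss_integrable[OF f] loss_integrable[OF g] by (simp add: loss_integral_def)
  finally show ?thesis .
qed

lemma ex_regularized_minimizer:
  "0 < lam \<Longrightarrow> \<exists>f. regularized_minimizer M l lam H ip f"
  unfolding regularized_minimizer_def
  using regularized_minimizer_exists[of lam "loss_integral M l", OF _ loss_integral_convex loss_integral_lipschitz]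
  by blast

lemma minimizer_mem: "regularized_minimizer M l lam H ip f \<Longrightarrow> f \<in> H"
  by (simp add: regularized_minimizer_def)

lemma minimizer_variational:
  assumes f: "regularized_minimizer M l lam H ip f" and lam: "0 < lam" and g: "g \<in> H"
  shows "0 \<le> loss_integral M l g - loss_integral M l f + 2 * lam * ip f (\<lambda>x. g x - f x)"
  using regularized_minimizer_variational[OF _ g lam loss_integral_convex[OF _ g]] f
  unfolding regularized_minimizer_def by blast

lemma minimizer_gap:
  assumes f: "regularized_minimizer M l lam H ip f" and lam: "0 < lam" and g: "g \<in> H"
  shows "loss_integral M l f + lam * (ip_norm ip f)\<^sup>2 + lam * (ip_norm ip (\<lambda>x. g x - f x))\<^sup>2
    \<le> loss_integral M l g + lam * (ip_norm ip g)\<^sup>2"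
  using regularized_minimizer_gap[OF _ g lam loss_integral_convex[OF _ g]] f
  unfolding regularized_minimizer_def by blast

text \<open>Comparison with the zero function, whose regularized risk is \<open>0\<close>: the
  penalty of \<open>f\<close> is at most the negative of its risk, which grows at most linearly in
  the norm.\<close>

lemma ip_norm_minimizer_le:
  assumes f: "regularized_minimizer M l lam H ip f" and lam: "0 < lam"
  shows "ip_norm ip f \<le> c * \<kappa> / lam"
proof -
  have mem: "f \<in> H" using f by (rule minimizer_mem)
  have "loss_integral M l f + lam * (ip_norm ip f)\<^sup>2 \<le> 0"
    using f zero_mem ip_zero_left[OF zero_mem] loss_integral_zero
    unfolding regularized_minimizer_def ip_norm_def by fastforce
  then have "lam * (ip_norm ip f)\<^sup>2 \<le> c * \<kappa> * ip_norm ip f"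
    using loss_integral_lipschitz[OF mem zero_mem] by (simp add: loss_integral_zero)
  then have "ip_norm ip f * (lam * ip_norm ip f) \<le> ip_norm ip f * (c * \<kappa>)"
    by (simp add: power2_eq_square algebra_simps)
  then have "lam * ip_norm ip f \<le> c * \<kappa>" if "ip_norm ip f \<noteq> 0"
    using that ip_norm_ge_zero[OF mem] by simp
  then show ?thesis
    using lam const_ge_zero kappa_ge_zero by (cases "ip_norm ip f = 0") (auto simp: field_simps)
qed

end

section \<open>Stability in the measure and in the regularization parameter\<close>

text \<open>Add the growth inequalities of \<open>f\<close> and \<open>g\<close>, each compared with
  the other. What survives is one risk increment integrated against \<open>M\<close> and against
  \<open>Q\<close>, bounded by total variation, and a difference of squared norms weighted by
  \<open>lam - lam'\<close>.\<close>

lemma (in regularized_risk) minimizer_perturbation: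
  assumes Q: "convex_lipschitz_loss Q l c" and sets: "sets Q = sets M"
    and f: "regularized_minimizer M l lam H ip f" and g: "regularized_minimizer Q l lam' H ip g"
    and tau: "0 < \<tau>" "\<tau> \<le> lam" "\<tau> \<le> lam'"
  shows "ip_norm ip (\<lambda>x. f x - g x)
    \<le> c * \<kappa> / \<tau> * (tv_norm M (\<lambda>E. measure M E - measure Q E) + \<bar>lam - lam'\<bar> / \<tau>)"
proof -
  interpret Q: convex_lipschitz_loss Q l c by fact
  interpret Q: regularized_risk k H ip \<kappa> Q l c ..
  note fH = minimizer_mem[OF f] and gH = Q.minimizer_mem[OF g]
  let ?T = "tv_norm M (\<lambda>E. measure M E - measure Q E)"
  define n where "n = ip_norm ip (\<lambda>x. f x - g x)"
  have n0: "0 \<le> n" unfolding n_def by (rule ip_norm_ge_zero[OF diff_mem[OF fH gH]])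
  have n': "n = ip_norm ip (\<lambda>x. g x - f x)"
    unfolding n_def by (rule ip_norm_minus_commute[OF fH gH])
  have gap: "(lam + lam') * n\<^sup>2 \<le> (loss_integral M l g - loss_integral M l f)
      - (loss_integral Q l g - loss_integral Q l f)
      + (lam - lam') * ((ip_norm ip g)\<^sup>2 - (ip_norm ip f)\<^sup>2)"
    using minimizer_gap[OF f _ gH] Q.minimizer_gap[OF g _ fH] tau
    by (simp add: algebra_simps flip: n_def n')
  have "(loss_integral M l g - loss_integral M l f) - (loss_integral Q l g - loss_integral Q l f)
      = (\<integral>z. l z (g (fst z)) - l z (f (fst z)) \<partial>M) - (\<integral>z. l z (g (fst z)) - l z (f (fst z)) \<partial>Q)"
    by (simp add: loss_integral_def loss_integrable Q.loss_integrable fH gH)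
  \<comment> \<open>The integrand is bounded by \<open>c * \<kappa> * n\<close>, so the distance
    \<open>n\<close> itself appears as a factor and can later be cancelled.\<close>
  also have "\<dots> \<le> c * \<kappa> * n * ?T"
    unfolding n'
  proof (rule order_trans[OF abs_ge_self],
      rule abs_integral_diff_le_tv_norm[OF prob_space_axioms Q.prob_space_axioms sets])
    show "(\<lambda>z. l z (g (fst z)) - l z (f (fst z))) \<in> borel_measurable M"
      by (intro borel_measurable_diff borel_measurable_integrable loss_integrable fH gH)
  qed (rule loss_diff_le[OF gH fH])
  finally have 1: "(loss_integral M l g - loss_integral M l f)
      - (loss_integral Q l g - loss_integral Q l f) \<le> c * \<kappa> * n * ?T" .
  have ck: "0 \<le> c * \<kappa>" using const_ge_zero kappa_ge_zero by simp
  have "c * \<kappa> / lam \<le> c * \<kappa> / \<tau>" "c * \<kappa> / lam' \<le> c * \<kappa> / \<tau>"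
    using tau ck by (simp_all add: divide_left_mono)
  then have le: "ip_norm ip f \<le> c * \<kappa> / \<tau>" "ip_norm ip g \<le> c * \<kappa> / \<tau>"
    using ip_norm_minimizer_le[OF f] Q.ip_norm_minimizer_le[OF g] tau by linarith+
  have "(lam - lam') * ((ip_norm ip g)\<^sup>2 - (ip_norm ip f)\<^sup>2)
      \<le> \<bar>lam - lam'\<bar> * (\<bar>ip_norm ip g - ip_norm ip f\<bar> * (ip_norm ip g + ip_norm ip f))"
  proof -
    have "\<bar>(ip_norm ip g)\<^sup>2 - (ip_norm ip f)\<^sup>2\<bar>
        = \<bar>ip_norm ip g - ip_norm ip f\<bar> * (ip_norm ip g + ip_norm ip f)"
      using ip_norm_ge_zero[OF fH] ip_norm_ge_zero[OF gH]
      by (simp add: power2_eq_square square_diff_square_factored abs_mult)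
    then show ?thesis
      using abs_ge_self[of "(lam - lam') * ((ip_norm ip g)\<^sup>2 - (ip_norm ip f)\<^sup>2)"]
      by (simp add: abs_mult)
  qed
  also have "\<dots> \<le> \<bar>lam - lam'\<bar> * (n * (2 * (c * \<kappa> / \<tau>)))"
    using ip_norm_triangle_diff[OF gH fH] le ip_norm_ge_zero[OF fH] ip_norm_ge_zero[OF gH]
    by (intro mult_left_mono mult_mono) (auto simp: n')
  finally have 2: "(lam - lam') * ((ip_norm ip g)\<^sup>2 - (ip_norm ip f)\<^sup>2)
      \<le> \<bar>lam - lam'\<bar> * (n * (2 * (c * \<kappa> / \<tau>)))" .
  have T0: "0 \<le> ?T"
    by (rule tv_norm_ge_zero[OF prob_space_axioms Q.prob_space_axioms sets])
  have "2 * \<tau> * n\<^sup>2 \<le> (lam + lam') * n\<^sup>2"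
    using tau by (intro mult_right_mono) auto
  \<comment> \<open>Doubling the total variation term gives both summands a factor \<open>2\<close>,
    which cancels against the one in \<open>2 * \<tau>\<close>.\<close>
  also have "\<dots> \<le> c * \<kappa> * n * (2 * ?T) + \<bar>lam - lam'\<bar> * (n * (2 * (c * \<kappa> / \<tau>)))"
    using gap 1 2 mult_nonneg_nonneg[OF mult_nonneg_nonneg[OF ck n0] T0] by simp
  also have "\<dots> = 2 * (n * (c * \<kappa> * (?T + \<bar>lam - lam'\<bar> / \<tau>)))"
    by (simp add: algebra_simps)
  finally have "n * (\<tau> * n) \<le> n * (c * \<kappa> * (?T + \<bar>lam - lam'\<bar> / \<tau>))"
    by (simp only: power2_eq_square mult.assoc mult.left_commute[of \<tau> n] mult_le_cancel_left_pos zero_less_numeral)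
  then have "\<tau> * n \<le> c * \<kappa> * (?T + \<bar>lam - lam'\<bar> / \<tau>)" if "n \<noteq> 0"
    using that n0 by simp
  moreover have "0 \<le> c * \<kappa> * (?T + \<bar>lam - lam'\<bar> / \<tau>)"
    using ck T0 tau by simp
  ultimately have "\<tau> * n \<le> c * \<kappa> * (?T + \<bar>lam - lam'\<bar> / \<tau>)" by (cases "n = 0") auto
  then show ?thesis
    using tau(1) by (simp add: pos_le_divide_eq mult.commute flip: n_def)
qed

section \<open>Smooth losses\<close>

text \<open>The function \<open>h\<close> plays the derivative of the loss, described by the tangent
  inequality and a Lipschitz bound. The constant \<open>K\<close> controls a second-order error only
  and disappears from the final estimates, so it may blow up as the smoothing is removed.\<close>

locale smooth_loss = convex_lipschitz_loss M l c
  for M :: "('a::topological_space \<times> real) measure" and l c +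
  fixes h :: "'a \<times> real \<Rightarrow> real \<Rightarrow> real" and K :: real
  assumes gradient_measurable: "case_prod h \<in> borel_measurable (M \<Otimes>\<^sub>M borel)"
    and gradient_bound: "\<And>z a. z \<in> space M \<Longrightarrow> \<bar>h z a\<bar> \<le> c"
    and gradient_le: "\<And>z a b. z \<in> space M \<Longrightarrow> l z a + h z a * (b - a) \<le> l z b"
    and gradient_lipschitz: "\<And>z a b. z \<in> space M \<Longrightarrow> \<bar>h z a - h z b\<bar> \<le> K * \<bar>a - b\<bar>"
begin

lemma gradient_mono:
  "z \<in> space M \<Longrightarrow> 0 \<le> (h z a - h z b) * (a - b)"
  using gradient_le[of z a b] gradient_le[of z b a] by (simp add: algebra_simps)

end

text \<open>The derivative of the average over \<open>{t..t + e}\<close> is a difference quotient of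
  the loss: increasing by convexity, bounded by \<open>c\<close>, and Lipschitz with constant
  \<open>2 * c / e\<close>. Being explicit, it is jointly measurable.\<close>

lemma (in convex_lipschitz_loss) smooth_approximation:
  assumes e: "0 < e"
  shows "\<exists>l' h K. smooth_loss M l' c h K \<and> (\<forall>z\<in>space M. \<forall>t. \<bar>l' z t - l z t\<bar> \<le> 2 * c * e)"
proof -
  define A where "A = (\<lambda>z t. \<integral>s. l z s * indicator {t..t + e} s \<partial>lborel)"
  \<comment> \<open>Subtracting the average at \<open>0\<close> restores \<open>loss_zero\<close>;
    its own error is why the distance to \<open>l\<close> is bounded by \<open>2 * c * e\<close>
    instead of \<open>c * e\<close>.\<close>
  define l' where "l' = (\<lambda>z t. (A z t - A z 0) / e)"
  define h where "h = (\<lambda>z t. (l z (t + e) - l z t) / e)"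
  have isCont_l: "isCont (l z) t" if z: "z \<in> space M" for z t
  proof -
    have "c-lipschitz_on UNIV (l z)"
      by (rule lipschitz_onI) (auto simp: dist_real_def const_ge_zero loss_lipschitz z)
    then have "continuous_on UNIV (l z)" by (rule lipschitz_on_continuous_on)
    then show ?thesis by (simp add: continuous_on_eq_continuous_at)
  qed
  have "\<exists>F. \<forall>t. (F has_real_derivative l z t) (at t)" if "z \<in> space M" for z
    using einterval_antiderivative[of "-\<infinity>" \<infinity> "l z"] isCont_l[OF that]
    by (auto simp: has_real_derivative_iff_has_vector_derivative)
  \<comment> \<open>These antiderivatives are chosen separately for each \<open>z\<close> and serve
    only calculus in \<open>t\<close>; measurability in \<open>z\<close> comes from the integral
    defining \<open>A\<close>.\<close>
  then obtain F where F: "\<And>z t. z \<in> space M \<Longrightarrow> (F z has_real_derivative l z t) (at t)"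
    by metis
  have A_eq: "A z t = F z (t + e) - F z t" if z: "z \<in> space M" for z t
    unfolding A_def using e by (intro integral_FTC_Icc_real F isCont_l z) auto
  have deriv: "(l' z has_real_derivative h z t) (at t)" if z: "z \<in> space M" for z t
  proof -
    have "((\<lambda>t. F z (t + e)) has_real_derivative l z (t + e)) (at t)"
      using F[OF z, of "t + e"] by (simp add: DERIV_shift)
    then have "((\<lambda>t. (F z (t + e) - F z t - A z 0) / e) has_real_derivative
        (l z (t + e) - l z t - 0) / e) (at t)"
      by (intro DERIV_cdivide DERIV_diff F[OF z] DERIV_const)
    then show ?thesis
      unfolding l'_def h_def by (simp add: A_eq[OF z])
  qed
  have mono: "h z a \<le> h z b" if z: "z \<in> space M" and ab: "a \<le> b" for z a b
  proof -
    \<comment> \<open>With this weight \<open>a + e\<close> and \<open>b\<close> are mirror-image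
      convex combinations of \<open>a\<close> and \<open>b + e\<close>; adding the two convexity
      inequalities compares the difference quotients.\<close>
    define t where "t = e / (b + e - a)"
    have t: "0 \<le> t" "t \<le> 1" using ab e by (auto simp: t_def)
    have eq: "t * (b + e - a) = e" using ab e by (simp add: t_def)
    then have "a + t * (b + e - a) = a + e" "a + (1 - t) * (b + e - a) = b"
      by (auto simp: algebra_simps)
    then have "l z (a + e) + l z b \<le> l z a + l z (b + e)"
      using loss_convex[OF z t, of a "b + e"] loss_convex[OF z, of "1 - t" a "b + e"] t
      by (simp add: algebra_simps)
    then show ?thesis using e by (simp add: h_def divide_right_mono)
  qed
  have bound: "\<bar>h z a\<bar> \<le> c" if z: "z \<in> space M" for z a
    using loss_lipschitz[OF z, of "a + e" a] e by (simp add: h_def abs_divide pos_divide_le_eq)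
  have le: "l' z a + h z a * (b - a) \<le> l' z b" if z: "z \<in> space M" for z a b
  proof (cases a b rule: linorder_cases)
    case less
    then obtain \<xi> where "a < \<xi>" "l' z b - l' z a = (b - a) * h z \<xi>"
      using MVT2[of a b "l' z" "h z"] deriv[OF z] by blast
    then show ?thesis
      using mult_left_mono[OF mono[OF z, of a \<xi>], of "b - a"] less by (simp add: algebra_simps)
  next
    case greater
    then obtain \<xi> where "\<xi> < a" "l' z a - l' z b = (a - b) * h z \<xi>"
      using MVT2[of b a "l' z" "h z"] deriv[OF z] by blast
    then show ?thesis
      using mult_left_mono[OF mono[OF z, of \<xi> a], of "a - b"] greater by (simp add: algebra_simps)
  qed simp
  have close: "\<bar>l' z t - l z t\<bar> \<le> 2 * c * e" if z: "z \<in> space M" for z t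
  proof -
    have avg: "\<bar>A z t / e - l z t\<bar> \<le> c * e" for t
    proof -
      obtain \<xi> where \<xi>: "t < \<xi>" "\<xi> < t + e" "F z (t + e) - F z t = (t + e - t) * l z \<xi>"
        using MVT2[of t "t + e" "F z" "l z"] F[OF z] e by auto
      then have "A z t / e = l z \<xi>" using e by (simp add: A_eq[OF z])
      then show ?thesis
        using loss_lipschitz[OF z, of \<xi> t] mult_left_mono[OF _ const_ge_zero, of "\<bar>\<xi> - t\<bar>" e] \<xi>
        by simp
    qed
    show ?thesis
      using avg[of t] avg[of 0] unfolding l'_def diff_divide_distrib loss_zero[OF z] by linarith
  qed
  have A_meas: "case_prod A \<in> borel_measurable (M \<Otimes>\<^sub>M borel)"
  proof -
    have [measurable]: "(\<lambda>p. l (fst (fst p)) (snd p)) \<in> borel_measurable ((M \<Otimes>\<^sub>M borel) \<Otimes>\<^sub>M borel)"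
    proof -
      have "(\<lambda>p. case_prod l (fst (fst p), snd p)) \<in> borel_measurable ((M \<Otimes>\<^sub>M borel) \<Otimes>\<^sub>M borel)"
        by (rule measurable_compose[OF _ loss_measurable]) measurable
      then show ?thesis by simp
    qed
    have "(\<lambda>p. \<integral>s. l (fst p) s * (if snd p \<le> s \<and> s \<le> snd p + e then 1 else 0) \<partial>lborel)
        \<in> borel_measurable (M \<Otimes>\<^sub>M borel)"
      by (intro lborel.borel_measurable_lebesgue_integral) (simp add: split_beta')
    then show ?thesis
      by (simp add: A_def split_beta' indicator_def)
  qed
  have [measurable]: "(\<lambda>p. l (fst p) (snd p)) \<in> borel_measurable (M \<Otimes>\<^sub>M borel)"
      "(\<lambda>p. A (fst p) (snd p)) \<in> borel_measurable (M \<Otimes>\<^sub>M borel)"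
    using loss_measurable A_meas by (simp_all add: split_beta')
  have [measurable]: "(\<lambda>p. l (fst p) (snd p + e)) \<in> borel_measurable (M \<Otimes>\<^sub>M borel)"
  proof -
    have "(\<lambda>p. case_prod l (fst p, snd p + e)) \<in> borel_measurable (M \<Otimes>\<^sub>M borel)"
      by (rule measurable_compose[OF _ loss_measurable]) measurable
    then show ?thesis by simp
  qed
  have [measurable]: "(\<lambda>p. A (fst p) 0) \<in> borel_measurable (M \<Otimes>\<^sub>M borel)"
  proof -
    have "(\<lambda>p. case_prod A (fst p, 0)) \<in> borel_measurable (M \<Otimes>\<^sub>M borel)"
      by (rule measurable_compose[OF _ A_meas]) measurable
    then show ?thesis by simp
  qed
  have "smooth_loss M l' c h (2 * c / e)"
  proof
    show "case_prod l' \<in> borel_measurable (M \<Otimes>\<^sub>M borel)"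
      unfolding l'_def split_beta' by measurable
    show "case_prod h \<in> borel_measurable (M \<Otimes>\<^sub>M borel)"
      unfolding h_def split_beta' by measurable
    fix z assume z: "z \<in> space M"
    show "l' z 0 = 0" by (simp add: l'_def)
    show "\<bar>l' z a - l' z b\<bar> \<le> c * \<bar>a - b\<bar>" for a b
    proof -
      have "\<bar>h z a * (b - a)\<bar> \<le> c * \<bar>a - b\<bar>" "\<bar>h z b * (a - b)\<bar> \<le> c * \<bar>a - b\<bar>"
        by (simp_all add: abs_mult abs_minus_commute bound[OF z] mult_right_mono)
      then show ?thesis using le[OF z, of a b] le[OF z, of b a] by linarith
    qed
    show "l' z (a + t * (b - a)) \<le> l' z a + t * (l' z b - l' z a)" if t: "0 \<le> t" "t \<le> 1" for a b t
    proof -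
      \<comment> \<open>Convexity is recovered by averaging the tangent inequalities at
        \<open>m\<close> towards \<open>a\<close> and \<open>b\<close>; the slope terms
        cancel.\<close>
      define m where "m = a + t * (b - a)"
      have "(1 - t) * (l' z m + h z m * (a - m)) + t * (l' z m + h z m * (b - m))
          \<le> (1 - t) * l' z a + t * l' z b"
        using t by (intro add_mono mult_left_mono le[OF z]) auto
      moreover have "(1 - t) * (l' z m + h z m * (a - m)) + t * (l' z m + h z m * (b - m)) = l' z m"
        by (simp add: m_def algebra_simps)
      ultimately have "l' z m \<le> (1 - t) * l' z a + t * l' z b" by simp
      then show ?thesis by (simp add: m_def algebra_simps)
    qed
    show "\<bar>h z a - h z b\<bar> \<le> 2 * c / e * \<bar>a - b\<bar>" for a b
    proof -
      have "\<bar>(l z (a + e) - l z (b + e)) - (l z a - l z b)\<bar> \<le> 2 * c * \<bar>a - b\<bar>"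
        using loss_lipschitz[OF z, of "a + e" "b + e"] loss_lipschitz[OF z, of a b] by simp
      moreover have "h z a - h z b = ((l z (a + e) - l z (b + e)) - (l z a - l z b)) / e"
        by (simp add: h_def diff_divide_distrib)
      ultimately show ?thesis
        using e by (simp add: abs_divide divide_right_mono)
    qed
  qed (use bound le const_ge_zero fst_measurable in auto)
  then show ?thesis using close by blast
qed

lemma (in regularized_risk)
  assumes w: "w \<in> borel_measurable M" "\<And>z. z \<in> space M \<Longrightarrow> \<bar>w z\<bar> \<le> b" and v: "v \<in> H"
  shows integrable_weighted: "integrable M (\<lambda>z. w z * v (fst z))"
    and abs_weighted_integral_le: "\<bar>\<integral>z. w z * v (fst z) \<partial>M\<bar> \<le> b * \<kappa> * ip_norm ip v"
proof -
  have le: "\<bar>w z * v (fst z)\<bar> \<le> b * \<kappa> * ip_norm ip v" if z: "z \<in> space M" for z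
    using mult_mono[OF w(2)[OF z] abs_le_ip_norm[OF v, of "fst z"]] w(2)[OF z]
    by (simp add: abs_mult mult.assoc)
  show int: "integrable M (\<lambda>z. w z * v (fst z))"
    by (rule integrable_const_bound[of _ "b * \<kappa> * ip_norm ip v"])
      (auto intro!: AE_I2 borel_measurable_times w mem_fst_measurable v le)
  show "\<bar>\<integral>z. w z * v (fst z) \<partial>M\<bar> \<le> b * \<kappa> * ip_norm ip v"
    by (rule abs_integral_le_const[OF int le])
qed

locale smooth_regularized_risk = regularized_risk k H ip \<kappa> M l c + smooth_loss M l c h K
  for k :: "'a::topological_space \<Rightarrow> 'a \<Rightarrow> real" and H ip \<kappa>
    and M :: "('a \<times> real) measure" and l c h K
begin

lemma gradient_at_measurable: "f \<in> H \<Longrightarrow> (\<lambda>z. h z (f (fst z))) \<in> borel_measurable M"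
  by (rule measurable_uncurry_compose[OF gradient_measurable mem_fst_measurable])

lemma integrable_gradient:
  "f \<in> H \<Longrightarrow> v \<in> H \<Longrightarrow> integrable M (\<lambda>z. h z (f (fst z)) * v (fst z))"
  by (rule integrable_weighted[OF gradient_at_measurable gradient_bound])

text \<open>The tangent inequality at the shifted point and the Lipschitz bound on \<open>h\<close>
  control the risk increment along \<open>v\<close> up to order \<open>t\<^sup>2\<close>. This
  yields one inequality, and the negative of \<open>v\<close> yields the other.\<close>

lemma representer:
  assumes f: "regularized_minimizer M l lam H ip f" and lam: "0 < lam" and v: "v \<in> H"
  shows "2 * lam * ip f v = - (\<integral>z. h z (f (fst z)) * v (fst z) \<partial>M)"
proof -
  have fH: "f \<in> H" using f by (rule minimizer_mem)
  let ?I = "\<lambda>g v. \<integral>z. h z (g (fst z)) * v (fst z) \<partial>M"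
  have ge: "0 \<le> ?I f v + 2 * lam * ip f v" if v: "v \<in> H" for v
  proof (rule nonneg_if_add_small_nonneg)
    fix t :: real assume t: "0 < t"
    let ?g = "\<lambda>x. f x + t * v x" and ?C = "K * (\<kappa> * ip_norm ip v)\<^sup>2"
    have g: "?g \<in> H" by (rule line_mem[OF fH v])
    have "loss_integral M l ?g - loss_integral M l f
        = (\<integral>z. l z (f (fst z) + t * v (fst z)) - l z (f (fst z)) \<partial>M)"
      using loss_integrable[OF g] loss_integrable[OF fH] by (simp add: loss_integral_def)
    also have "\<dots> \<le> (\<integral>z. t * (h z (f (fst z)) * v (fst z) + t * ?C) \<partial>M)"
    proof (rule Bochner_Integration.integral_mono)
      fix z assume z: "z \<in> space M"
      let ?a = "f (fst z)" and ?v = "v (fst z)"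
      have "(h z (?a + t * ?v) - h z ?a) * ?v \<le> K * \<bar>t * ?v\<bar> * \<bar>?v\<bar>"
        using mult_right_mono[OF gradient_lipschitz[OF z, of "?a + t * ?v" ?a], of "\<bar>?v\<bar>"]
        by (intro order_trans[OF abs_ge_self[of "_ * ?v"]]) (simp add: abs_mult)
      also have "\<dots> = t * (K * \<bar>?v\<bar>\<^sup>2)"
        using t by (simp add: abs_mult power2_eq_square)
      also have "\<dots> \<le> t * ?C"
        \<comment> \<open>The points \<open>1\<close> and \<open>0\<close> show that
          \<open>K\<close> is nonnegative.\<close>
        using t gradient_lipschitz[OF z, of 1 0] abs_le_ip_norm[OF v, of "fst z"]
        by (intro mult_left_mono power_mono) auto
      finally have "h z (?a + t * ?v) * ?v \<le> h z ?a * ?v + t * ?C"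
        by (simp add: algebra_simps)
      then have "t * (h z (?a + t * ?v) * ?v) \<le> t * (h z ?a * ?v + t * ?C)"
        using t by simp
      \<comment> \<open>The tangent is taken at \<open>?a + t * ?v\<close> and evaluated at
        \<open>?a\<close>, which bounds the increment from above.\<close>
      then show "l z (?a + t * ?v) - l z ?a \<le> t * (h z ?a * ?v + t * ?C)"
        using gradient_le[OF z, of "?a + t * ?v" ?a] by (simp add: algebra_simps)
    qed (use loss_integrable[OF g] loss_integrable[OF fH] integrable_gradient[OF fH v] in auto)
    also have "\<dots> = t * (?I f v + t * ?C)"
      using integrable_gradient[OF fH v] by (simp add: prob_space)
    finally have "0 \<le> t * (?I f v + t * ?C) + 2 * lam * (t * ip f v)"
      using minimizer_variational[OF f lam g] by (simp add: ip_scale_right[OF v fH])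
    then have "0 \<le> t * (?I f v + 2 * lam * ip f v + t * ?C)"
      by (simp add: algebra_simps)
    then show "0 \<le> ?I f v + 2 * lam * ip f v + t * ?C"
      using t by (simp add: zero_le_mult_iff)
  qed
  show ?thesis
    using ge[OF v] ge[OF scale_mem[OF v, of "-1"]] ip_scale_right[OF v fH, of "-1"] by simp
qed

end

section \<open>Stability in the kernel\<close>

lemma kernel_perturbation_smooth:
  assumes "smooth_regularized_risk k1 H1 ip1 \<kappa> M l c h K"
    and "smooth_regularized_risk k2 H2 ip2 \<kappa> M l c h K"
    and f1: "regularized_minimizer M l lam H1 ip1 f1" and f2: "regularized_minimizer M l lam H2 ip2 f2"
    and lam: "0 < lam" and D: "\<And>x x'. \<bar>k1 x x' - k2 x x'\<bar> \<le> D"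
  shows "\<bar>f1 x - f2 x\<bar> \<le> c / lam * (D / 2 + \<kappa> * sqrt D)"
proof -
  interpret S1: smooth_regularized_risk k1 H1 ip1 \<kappa> M l c h K by fact
  interpret S2: smooth_regularized_risk k2 H2 ip2 \<kappa> M l c h K by fact
  note m1 = S1.minimizer_mem[OF f1] and m2 = S2.minimizer_mem[OF f2]
  define w1 where "w1 = (\<lambda>z. h z (f1 (fst z)))"
  define w2 where "w2 = (\<lambda>z. h z (f2 (fst z)))"
  have w: "w1 \<in> borel_measurable M" "w2 \<in> borel_measurable M"
      "\<And>z. z \<in> space M \<Longrightarrow> \<bar>w1 z\<bar> \<le> c" "\<And>z. z \<in> space M \<Longrightarrow> \<bar>w2 z\<bar> \<le> c"
    unfolding w1_def w2_def
    using S1.gradient_at_measurable[OF m1] S2.gradient_at_measurable[OF m2] S1.gradient_bound by auto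
  have D0: "0 \<le> D" using D[of x x] by linarith
  have int: "\<And>v. v \<in> H2 \<Longrightarrow> integrable M (\<lambda>z. w1 z * v (fst z))"
      "\<And>v. v \<in> H2 \<Longrightarrow> integrable M (\<lambda>z. w2 z * v (fst z))"
      "\<And>v. v \<in> H1 \<Longrightarrow> integrable M (\<lambda>z. w1 z * v (fst z))"
    using S2.integrable_weighted[OF w(1), of c] S2.integrable_weighted[OF w(2), of c]
      S1.integrable_weighted[OF w(1), of c] w(3,4) by blast+
  \<comment> \<open>The witness \<open>g\<close> transports \<open>f1\<close> to \<open>H2\<close>:
    it satisfies the representer formula of \<open>H2\<close>, but with the gradient weights
    \<open>w1\<close> of \<open>f1\<close>.\<close>
  have "\<exists>g\<in>H2. \<forall>v\<in>H2. ip2 g v = - (\<integral>z. w1 z * v (fst z) \<partial>M) / (2 * lam)"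
  proof (rule S2.Riesz_representation[where C = "c * \<kappa> / (2 * lam)"])
    fix v assume v: "v \<in> H2"
    show "\<bar>- (\<integral>z. w1 z * v (fst z) \<partial>M) / (2 * lam)\<bar> \<le> c * \<kappa> / (2 * lam) * ip_norm ip2 v"
      using S2.abs_weighted_integral_le[OF w(1) _ v, of c] w(3) lam by (simp add: divide_right_mono)
    show "- (\<integral>z. w1 z * (r * v (fst z)) \<partial>M) / (2 * lam) = r * (- (\<integral>z. w1 z * v (fst z) \<partial>M) / (2 * lam))" for r
      by (simp add: mult.left_commute[of _ r])
  qed (use int in \<open>simp add: distrib_left diff_divide_distrib\<close>)
  then obtain g where g: "g \<in> H2"
    and ip_g: "\<And>v. v \<in> H2 \<Longrightarrow> 2 * lam * ip2 g v = - (\<integral>z. w1 z * v (fst z) \<partial>M)"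
    using lam by (auto simp: field_simps)
  have f1_g: "\<bar>f1 y - g y\<bar> \<le> c * D / (2 * lam)" for y
  proof -
    \<comment> \<open>Tested on kernel sections, \<open>f1 y\<close> and \<open>g y\<close> are the
      same weighted integral of \<open>k1\<close> and of \<open>k2\<close>, so only the difference
      of the kernels remains.\<close>
    have "2 * lam * (f1 y - g y) = (\<integral>z. w1 z * k2 (fst z) y \<partial>M) - (\<integral>z. w1 z * k1 (fst z) y \<partial>M)"
      using S1.representer[OF f1 lam S1.kernel_section_mem, of y] ip_g[OF S2.kernel_section_mem, of y]
        S1.reproducing[OF m1, of y] S2.reproducing[OF g, of y]
      by (simp add: w1_def right_diff_distrib)
    also have "\<dots> = (\<integral>z. w1 z * (k2 (fst z) y - k1 (fst z) y) \<partial>M)"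
      using int(1)[OF S2.kernel_section_mem] int(3)[OF S1.kernel_section_mem]
      by (simp add: right_diff_distrib)
    also have "\<bar>\<dots>\<bar> \<le> c * D"
    proof (rule S1.abs_integral_le_const)
      show "integrable M (\<lambda>z. w1 z * (k2 (fst z) y - k1 (fst z) y))"
        using int(1)[OF S2.kernel_section_mem] int(3)[OF S1.kernel_section_mem]
        by (simp add: right_diff_distrib)
      fix z assume z: "z \<in> space M"
      show "\<bar>w1 z * (k2 (fst z) y - k1 (fst z) y)\<bar> \<le> c * D"
        unfolding abs_mult abs_minus_commute[of "k2 _ _"]
        by (intro mult_mono w D S1.const_ge_zero z) simp
    qed
    finally show ?thesis
      using lam unfolding abs_mult by (simp add: pos_le_divide_eq ac_simps)
  qed
  define n where "n = ip_norm ip2 (\<lambda>x. f2 x - g x)"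
  have d: "(\<lambda>x. f2 x - g x) \<in> H2" by (rule S2.diff_mem[OF m2 g])
  have n0: "0 \<le> n" unfolding n_def by (rule S2.ip_norm_ge_zero[OF d])
  \<comment> \<open>Both \<open>f2\<close> and \<open>g\<close> obey representer formulas in
    \<open>H2\<close>, with weights \<open>w2\<close> and \<open>w1\<close>; testing them on
    \<open>f2 - g\<close> leaves the integral of \<open>(w1 - w2) * (f2 - g)\<close>.\<close>
  have "2 * lam * n\<^sup>2 = 2 * lam * ip2 f2 (\<lambda>x. f2 x - g x) - 2 * lam * ip2 g (\<lambda>x. f2 x - g x)"
    by (simp add: n_def S2.ip_norm_power2[OF d] S2.ip_diff_left[OF m2 g d] right_diff_distrib)
  also have "\<dots> = (\<integral>z. w1 z * (f2 (fst z) - g (fst z)) \<partial>M) - (\<integral>z. w2 z * (f2 (fst z) - g (fst z)) \<partial>M)"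
    using S2.representer[OF f2 lam d] ip_g[OF d] by (simp add: w2_def)
  also have "\<dots> = (\<integral>z. w1 z * (f2 (fst z) - g (fst z)) - w2 z * (f2 (fst z) - g (fst z)) \<partial>M)"
    using int(1,2)[OF d] by simp
  also have "\<dots> \<le> c\<^sup>2 * D / lam"
  proof (rule S1.integral_le_const)
    show "integrable M (\<lambda>z. w1 z * (f2 (fst z) - g (fst z)) - w2 z * (f2 (fst z) - g (fst z)))"
      using int(1,2)[OF d] by simp
    have "w1 z * (f2 (fst z) - g (fst z)) - w2 z * (f2 (fst z) - g (fst z)) \<le> c\<^sup>2 * D / lam"
      if z: "z \<in> space M" for z
    proof -
      let ?y = "fst z"
      \<comment> \<open>Split \<open>f2 - g\<close> as \<open>(f1 - g) - (f1 - f2)\<close>: the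
        first part is small uniformly, and monotonicity of \<open>h\<close> makes the contribution
        of the second nonpositive.\<close>
      have "(w1 z - w2 z) * (f1 ?y - g ?y) \<le> (2 * c) * (c * D / (2 * lam))"
      proof -
        have "\<bar>w1 z - w2 z\<bar> \<le> 2 * c" using w(3,4)[OF z] by linarith
        then have "\<bar>w1 z - w2 z\<bar> * \<bar>f1 ?y - g ?y\<bar> \<le> (2 * c) * (c * D / (2 * lam))"
          using f1_g S1.const_ge_zero by (intro mult_mono) auto
        then show ?thesis using abs_ge_self[of "(w1 z - w2 z) * (f1 ?y - g ?y)"]
          unfolding abs_mult by linarith
      qed
      moreover have "0 \<le> (w1 z - w2 z) * (f1 ?y - f2 ?y)"
        using S1.gradient_mono[OF z] by (simp add: w1_def w2_def)
      moreover have "(2 * c) * (c * D / (2 * lam)) = c\<^sup>2 * D / lam"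
        by (simp add: power2_eq_square)
      ultimately show ?thesis unfolding left_diff_distrib right_diff_distrib by linarith
    qed
    then show "AE z in M. w1 z * (f2 (fst z) - g (fst z)) - w2 z * (f2 (fst z) - g (fst z)) \<le> c\<^sup>2 * D / lam"
      by (rule AE_I2)
  qed
  finally have "2 * n\<^sup>2 \<le> (c / lam * sqrt D)\<^sup>2"
    using lam D0 by (simp add: power_mult_distrib power_divide field_simps power2_eq_square)
  \<comment> \<open>The factor \<open>2\<close> is given away here to reach the stated
    constant.\<close>
  then have "n\<^sup>2 \<le> (c / lam * sqrt D)\<^sup>2"
    using zero_le_power2[of n] by linarith
  then have "n \<le> c / lam * sqrt D"
    by (rule power2_le_imp_le) (use lam D0 S1.const_ge_zero in auto)
  from mult_left_mono[OF this S2.kappa_ge_zero]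
  have "\<bar>f2 x - g x\<bar> \<le> \<kappa> * (c / lam * sqrt D)"
    using S2.abs_le_ip_norm[OF d, of x] unfolding n_def by (rule order_trans[rotated])
  moreover have "c / lam * (D / 2 + \<kappa> * sqrt D) = c * D / (2 * lam) + \<kappa> * (c / lam * sqrt D)"
    by (simp add: algebra_simps)
  ultimately show ?thesis
    using f1_g[of x] by linarith
qed

text \<open>Adding both growth inequalities gives \<open>2 * lam * n\<^sup>2\<close> on the left and
  at most \<open>2 * \<eta>\<close> on the right, since each of the two minimizers sees a risk
  change of at most \<open>\<eta>\<close>.\<close>

lemma (in regularized_risk) loss_perturbation:
  assumes l': "convex_lipschitz_loss M l' c" and close: "\<And>z t. z \<in> space M \<Longrightarrow> \<bar>l' z t - l z t\<bar> \<le> \<eta>"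
    and f: "regularized_minimizer M l lam H ip f" and g: "regularized_minimizer M l' lam H ip g"
    and lam: "0 < lam"
  shows "\<bar>f x - g x\<bar> \<le> \<kappa> * sqrt (\<eta> / lam)"
proof -
  interpret L': convex_lipschitz_loss M l' c by fact
  interpret L': regularized_risk k H ip \<kappa> M l' c ..
  note fH = minimizer_mem[OF f] and gH = L'.minimizer_mem[OF g]
  define n where "n = ip_norm ip (\<lambda>x. f x - g x)"
  have n': "n = ip_norm ip (\<lambda>x. g x - f x)"
    unfolding n_def by (rule ip_norm_minus_commute[OF fH gH])
  have risk: "\<bar>loss_integral M l' v - loss_integral M l v\<bar> \<le> \<eta>" if v: "v \<in> H" for v
  proof -
    have "\<bar>\<integral>z. l' z (v (fst z)) - l z (v (fst z)) \<partial>M\<bar> \<le> \<eta>"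
      using loss_integrable[OF v] L'.loss_integrable[OF v] close
      by (intro abs_integral_le_const) auto
    then show ?thesis
      using loss_integrable[OF v] L'.loss_integrable[OF v] by (simp add: loss_integral_def)
  qed
  have "lam * n\<^sup>2 \<le> \<eta>"
    using minimizer_gap[OF f lam gH] L'.minimizer_gap[OF g lam fH] risk[OF fH] risk[OF gH]
    by (simp flip: n_def n')
  then have "n\<^sup>2 \<le> \<eta> / lam" using lam by (simp add: field_simps)
  then have "n \<le> sqrt (\<eta> / lam)" by (rule real_le_rsqrt)
  from mult_left_mono[OF this kappa_ge_zero] show ?thesis
    using abs_le_ip_norm[OF diff_mem[OF fH gH], of x] unfolding n_def by (rule order_trans[rotated])
qed

text \<open>Smooth the loss, move each minimizer to the smoothed problem in its own space, apply the
  smooth case and remove the smoothing.\<close>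

lemma kernel_perturbation:
  assumes "regularized_risk k1 H1 ip1 \<kappa> M l c" and "regularized_risk k2 H2 ip2 \<kappa> M l c"
    and f1: "regularized_minimizer M l lam H1 ip1 f1" and f2: "regularized_minimizer M l lam H2 ip2 f2"
    and lam: "0 < lam" and D: "\<And>x x'. \<bar>k1 x x' - k2 x x'\<bar> \<le> D"
  shows "\<bar>f1 x - f2 x\<bar> \<le> c / lam * (D / 2 + \<kappa> * sqrt D)" (is "_ \<le> ?B")
proof -
  interpret R1: regularized_risk k1 H1 ip1 \<kappa> M l c by fact
  interpret R2: regularized_risk k2 H2 ip2 \<kappa> M l c by fact
  let ?C = "2 * (\<kappa> * sqrt (2 * c / lam))"
  have "0 \<le> (?B - \<bar>f1 x - f2 x\<bar>) + t * ?C" if t: "0 < t" for t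
  proof -
    obtain l' h K where "smooth_loss M l' c h K"
      and close: "\<And>z a. z \<in> space M \<Longrightarrow> \<bar>l' z a - l z a\<bar> \<le> 2 * c * t\<^sup>2"
      \<comment> \<open>Averaging over length \<open>t\<^sup>2\<close> makes the error linear in
        \<open>t\<close> after the square root of \<open>loss_perturbation\<close>.\<close>
      using R1.smooth_approximation[of "t\<^sup>2"] t by auto
    interpret S: smooth_loss M l' c h K by fact
    interpret S1: smooth_regularized_risk k1 H1 ip1 \<kappa> M l' c h K ..
    interpret S2: smooth_regularized_risk k2 H2 ip2 \<kappa> M l' c h K ..
    obtain g1 g2 where g: "regularized_minimizer M l' lam H1 ip1 g1" "regularized_minimizer M l' lam H2 ip2 g2"
      using S1.ex_regularized_minimizer[OF lam] S2.ex_regularized_minimizer[OF lam] by blast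
    have "\<bar>f1 x - g1 x\<bar> \<le> \<kappa> * sqrt (2 * c * t\<^sup>2 / lam)"
      by (rule R1.loss_perturbation[OF S.convex_lipschitz_loss_axioms close f1 g(1) lam])
    moreover have "\<bar>f2 x - g2 x\<bar> \<le> \<kappa> * sqrt (2 * c * t\<^sup>2 / lam)"
      by (rule R2.loss_perturbation[OF S.convex_lipschitz_loss_axioms close f2 g(2) lam])
    moreover have "\<bar>g1 x - g2 x\<bar> \<le> ?B"
      by (rule kernel_perturbation_smooth[OF S1.smooth_regularized_risk_axioms
            S2.smooth_regularized_risk_axioms g lam D])
    moreover have "sqrt (2 * c * t\<^sup>2 / lam) = t * sqrt (2 * c / lam)"
      using t by (simp add: real_sqrt_mult real_sqrt_divide)
    ultimately show ?thesis by (simp add: algebra_simps)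
  qed
  then have "0 \<le> ?B - \<bar>f1 x - f2 x\<bar>" by (rule nonneg_if_add_small_nonneg)
  then show ?thesis by simp
qed

section \<open>Stability of support vector machines\<close>

text \<open>The infimum is attained: for distinct \<open>a\<close> and \<open>b\<close> every
  admissible constant dominates the difference quotient, hence so does the infimum.\<close>

lemma lipschitz_loss_with_const:
  assumes "lipschitz_loss Y L"
  shows "lipschitz_loss_with Y L (lipschitz_const Y L)"
proof -
  let ?S = "{c. lipschitz_loss_with Y L c}"
  have ne: "?S \<noteq> {}" using assms by (simp add: lipschitz_loss_def)
  have "dist (L x y a) (L x y b) \<le> lipschitz_const Y L * dist a b" if y: "y \<in> Y" for x y a b
  proof (cases "a = b")
    case False
    have "dist (L x y a) (L x y b) / dist a b \<le> lipschitz_const Y L"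
      unfolding lipschitz_const_def
    proof (rule cInf_greatest[OF ne])
      fix c assume "c \<in> ?S"
      then have "dist (L x y a) (L x y b) \<le> c * dist a b"
        using y by (auto simp: lipschitz_loss_with_def intro: lipschitz_onD)
      then show "dist (L x y a) (L x y b) / dist a b \<le> c"
        using False by (simp add: pos_divide_le_eq)
    qed
    then show ?thesis using False by (simp add: pos_divide_le_eq)
  qed simp
  moreover have "0 \<le> lipschitz_const Y L"
    unfolding lipschitz_const_def by (rule cInf_greatest[OF ne]) (simp add: lipschitz_loss_with_def)
  ultimately show ?thesis
    by (simp add: lipschitz_loss_with_def lipschitz_on_def)
qed

lemma convex_lipschitz_loss_shifted:
  fixes P :: "('a::polish_space \<times> real) measure"
  assumes P: "borel_prob_on Y P" and L: "loss_function Y L" "convex_loss Y L" "lipschitz_loss Y L"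
  shows "convex_lipschitz_loss P (\<lambda>z. shifted_loss L (fst z) (snd z)) (lipschitz_const Y L)"
proof -
  let ?c = "lipschitz_const Y L"
  interpret prob_space P using P by (simp add: borel_prob_on_def)
  have sets: "sets P = sets (restrict_space borel (UNIV \<times> Y))"
    using P by (simp add: borel_prob_on_def)
  have Y: "snd z \<in> Y" if "z \<in> space P" for z
  proof -
    have "z \<in> UNIV \<times> Y"
      using that unfolding sets_eq_imp_space_eq[OF sets] space_restrict_space by simp
    then show ?thesis by (simp add: mem_Times_iff)
  qed
  have id: "(\<lambda>z. z) \<in> borel_measurable P"
    using measurable_restrict_space1[OF measurable_ident, of borel "UNIV \<times> Y"]
    by (simp add: measurable_cong_sets[OF sets refl] id_def)
  have fst: "fst \<in> borel_measurable (borel :: ('a \<times> real) measure)"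
    and snd: "snd \<in> borel_measurable (borel :: ('a \<times> real) measure)"
    by (intro borel_measurable_continuous_onI continuous_intros)+
  have lip: "?c-lipschitz_on UNIV (L x y)" if "y \<in> Y" for x y
    using lipschitz_loss_with_const[OF L(3)] that by (simp add: lipschitz_loss_with_def)
  \<comment> \<open>A general third argument \<open>g\<close> covers both terms of the shifted loss:
    the projection \<open>snd\<close> and the constant \<open>0\<close>.\<close>
  have meas_L: "(\<lambda>p. L (fst (fst p)) (snd (fst p)) (g p)) \<in> borel_measurable (P \<Otimes>\<^sub>M borel)"
    if g: "g \<in> borel_measurable (P \<Otimes>\<^sub>M borel)" for g
  proof -
    have "(\<lambda>p. fst p) \<in> measurable (P \<Otimes>\<^sub>M borel) borel"
      by (rule measurable_compose[OF measurable_fst id])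
    then have "(\<lambda>p. fst (fst p)) \<in> borel_measurable (P \<Otimes>\<^sub>M borel)"
      "(\<lambda>p. snd (fst p)) \<in> borel_measurable (P \<Otimes>\<^sub>M borel)"
      using measurable_compose[OF _ fst] measurable_compose[OF _ snd] by blast+
    then have "(\<lambda>p. (fst (fst p), snd (fst p), g p)) \<in> borel_measurable (P \<Otimes>\<^sub>M borel)"
      by (intro borel_measurable_Pair g)
    then have "(\<lambda>p. (fst (fst p), snd (fst p), g p))
        \<in> measurable (P \<Otimes>\<^sub>M borel) (restrict_space borel (UNIV \<times> Y \<times> UNIV))"
      by (rule measurable_restrict_space2[rotated]) (simp add: Pi_iff mem_Times_iff space_pair_measure Y)
    from measurable_compose[OF this, of "\<lambda>(x, y, t). L x y t" borel] show ?thesis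
      using L(1) by (simp add: loss_function_def)
  qed
  show ?thesis
  proof
    show "fst \<in> borel_measurable P"
      using measurable_compose[OF id fst] by simp
    show "(\<lambda>(z, t). shifted_loss L (fst z) (snd z) t) \<in> borel_measurable (P \<Otimes>\<^sub>M borel)"
      unfolding shifted_loss_def split_beta'
      by (intro borel_measurable_diff meas_L measurable_snd borel_measurable_const)
    show "0 \<le> ?c"
      using lipschitz_loss_with_const[OF L(3)] by (simp add: lipschitz_loss_with_def)
    fix z assume z: "z \<in> space P"
    show "shifted_loss L (fst z) (snd z) 0 = 0" by (simp add: shifted_loss_def)
    show "\<bar>shifted_loss L (fst z) (snd z) a - shifted_loss L (fst z) (snd z) b\<bar> \<le> ?c * \<bar>a - b\<bar>" for a b
      using lipschitz_onD[OF lip[OF Y[OF z]], of a b "fst z"] by (simp add: shifted_loss_def dist_real_def)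
    show "shifted_loss L (fst z) (snd z) (a + t * (b - a))
        \<le> shifted_loss L (fst z) (snd z) a + t * (shifted_loss L (fst z) (snd z) b - shifted_loss L (fst z) (snd z) a)"
      if t: "0 \<le> t" "t \<le> 1" for a b t
    proof -
      have "convex_on UNIV (L (fst z) (snd z))"
        using L(2) Y[OF z] by (simp add: convex_loss_def)
      from convex_onD[OF this t, of a b] show ?thesis
        by (simp add: shifted_loss_def algebra_simps)
    qed
  qed
qed

lemma bounded_rkhs_of_kernel:
  fixes k :: "'a::polish_space \<Rightarrow> 'a \<Rightarrow> real"
  assumes "rkhs k H ip" "measurable_kernel k" "bounded_kernel k" "kernel_norm k \<le> \<kappa>"
  shows "bounded_rkhs k H ip \<kappa>"
proof -
  interpret rkhs k H ip by fact
  show ?thesis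
  proof
    show "sqrt (k x x) \<le> \<kappa>" for x
      using cSUP_upper[of x UNIV "\<lambda>x. sqrt (k x x)"] assms(3,4)
      by (auto simp: bounded_kernel_def kernel_norm_def)
    show "(\<lambda>x'. k x' x) \<in> borel_measurable borel" for x
      using measurable_compose[of "\<lambda>x'. (x', x)" borel borel "\<lambda>(x, x'). k x x'"] assms(2)
      by (simp add: measurable_kernel_def borel_measurable_Pair)
  qed
qed

text \<open>\<open>arg_min_on\<close> is an arbitrary choice, and the existence of a minimizer is
  what turns its value into one.\<close>

lemma (in regularized_risk) regularized_minimizer_arg_min:
  assumes lam: "0 < lam"
  shows "regularized_minimizer M l lam H ip
    (arg_min_on (\<lambda>f. loss_integral M l f + lam * (ip_norm ip f)\<^sup>2) H)"
proof -
  let ?J = "\<lambda>f. loss_integral M l f + lam * (ip_norm ip f)\<^sup>2"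
  have "\<exists>f. is_arg_min ?J (\<lambda>f. f \<in> H) f"
    using ex_regularized_minimizer[OF lam]
    by (simp add: is_arg_min_linorder regularized_minimizer_def Ball_def)
  then have "is_arg_min ?J (\<lambda>f. f \<in> H) (arg_min_on ?J H)"
    unfolding arg_min_on_def arg_min_def by (rule someI_ex)
  then show ?thesis
    by (simp add: is_arg_min_linorder regularized_minimizer_def)
qed

lemma svm_eq_arg_min:
  "svm L P lam H ip = arg_min_on (\<lambda>f. loss_integral P (\<lambda>z. shifted_loss L (fst z) (snd z)) f
    + lam * (ip_norm ip f)\<^sup>2) H"
  by (simp add: svm_def risk_def loss_integral_def)

theorem theorem2p1:
  fixes Y :: "real set"
    and P1 P2 :: "('a::polish_space \<times> real) measure"
    and lam1 lam2 \<kappa> \<tau> :: real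
    and k1 k2 :: "'a \<Rightarrow> 'a \<Rightarrow> real"
    and H1 H2 :: "('a \<Rightarrow> real) set"
    and ip1 ip2 :: "('a \<Rightarrow> real) \<Rightarrow> ('a \<Rightarrow> real) \<Rightarrow> real"
    and L :: "'a \<Rightarrow> real \<Rightarrow> real \<Rightarrow> real"
  assumes "closed Y"
    and "borel_prob_on Y P1" and "borel_prob_on Y P2"
    and "lam1 > 0" and "lam2 > 0"
    and "psd_kernel k1" and "measurable_kernel k1" and "bounded_kernel k1"
    and "psd_kernel k2" and "measurable_kernel k2" and "bounded_kernel k2"
    and "rkhs k1 H1 ip1" and "separable_ip_space H1 ip1"
    and "rkhs k2 H2 ip2" and "separable_ip_space H2 ip2"
    and "\<kappa> = max (kernel_norm k1) (kernel_norm k2)"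
    and "\<tau> = min lam1 lam2"
    and "loss_function Y L" and "convex_loss Y L" and "lipschitz_loss Y L"
  shows "sup_norm (\<lambda>x. svm L P1 lam1 H1 ip1 x - svm L P2 lam2 H2 ip2 x)
    \<le> lipschitz_const Y L / \<tau> *
       (\<kappa>\<^sup>2 * tv_norm P1 (\<lambda>E. measure P1 E - measure P2 E)
        + \<kappa>\<^sup>2 / \<tau> * \<bar>lam1 - lam2\<bar>
        + 1 / 2 * sup_norm (\<lambda>(x, x'). k1 x x' - k2 x x')
        + \<kappa> * sqrt (sup_norm (\<lambda>(x, x'). k1 x x' - k2 x x')))"
proof -
  let ?l = "\<lambda>z. shifted_loss L (fst z) (snd z)"
  let ?c = "lipschitz_const Y L" and ?T = "tv_norm P1 (\<lambda>E. measure P1 E - measure P2 E)"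
  define D where "D = sup_norm (\<lambda>(x, x'). k1 x x' - k2 x x')"
  interpret B1: bounded_rkhs k1 H1 ip1 \<kappa> by (rule bounded_rkhs_of_kernel) (use assms in auto)
  interpret B2: bounded_rkhs k2 H2 ip2 \<kappa> by (rule bounded_rkhs_of_kernel) (use assms in auto)
  interpret C1: convex_lipschitz_loss P1 ?l ?c
    by (rule convex_lipschitz_loss_shifted) (use assms in auto)
  interpret C2: convex_lipschitz_loss P2 ?l ?c
    by (rule convex_lipschitz_loss_shifted) (use assms in auto)
  interpret R11: regularized_risk k1 H1 ip1 \<kappa> P1 ?l ?c ..
  interpret R12: regularized_risk k1 H1 ip1 \<kappa> P2 ?l ?c ..
  interpret R22: regularized_risk k2 H2 ip2 \<kappa> P2 ?l ?c ..
  have tau: "0 < \<tau>" "\<tau> \<le> lam1" "\<tau> \<le> lam2" using assms by auto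
  have sets: "sets P2 = sets P1"
    using assms(2,3) by (simp add: borel_prob_on_def)
  have D: "\<bar>k1 x x' - k2 x x'\<bar> \<le> D" for x x'
  proof -
    have "\<bar>k1 x x' - k2 x x'\<bar> \<le> 2 * \<kappa>\<^sup>2" for x x'
      using B1.abs_kernel_le[of x x'] B2.abs_kernel_le[of x x'] by linarith
    \<comment> \<open>Bounded kernels make the supremum finite; otherwise it would not dominate the
      pointwise differences.\<close>
    then have "bdd_above (range (\<lambda>p. \<bar>case p of (x, x') \<Rightarrow> k1 x x' - k2 x x'\<bar>))"
      by (intro bdd_aboveI2[where M = "2 * \<kappa>\<^sup>2"]) (simp add: split_beta)
    from cSUP_upper[OF UNIV_I this, of "(x, x')"] show ?thesis
      by (simp add: D_def sup_norm_def)
  qed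
  \<comment> \<open>The intermediate minimizer shares its space with the first SVM and its measure
    and parameter with the second.\<close>
  obtain g where g: "regularized_minimizer P2 ?l lam2 H1 ip1 g"
    using R12.ex_regularized_minimizer[OF \<open>lam2 > 0\<close>] by blast
  have f1: "regularized_minimizer P1 ?l lam1 H1 ip1 (svm L P1 lam1 H1 ip1)"
    unfolding svm_eq_arg_min by (rule R11.regularized_minimizer_arg_min[OF \<open>lam1 > 0\<close>])
  have f2: "regularized_minimizer P2 ?l lam2 H2 ip2 (svm L P2 lam2 H2 ip2)"
    unfolding svm_eq_arg_min by (rule R22.regularized_minimizer_arg_min[OF \<open>lam2 > 0\<close>])
  have D0: "0 \<le> D" using D[of undefined undefined] by linarith
  have "\<bar>svm L P1 lam1 H1 ip1 x - svm L P2 lam2 H2 ip2 x\<bar>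
      \<le> ?c / \<tau> * (\<kappa>\<^sup>2 * ?T + \<kappa>\<^sup>2 / \<tau> * \<bar>lam1 - lam2\<bar> + 1 / 2 * D + \<kappa> * sqrt D)" for x
  proof -
    have "\<bar>svm L P1 lam1 H1 ip1 x - g x\<bar> \<le> \<kappa> * ip_norm ip1 (\<lambda>x. svm L P1 lam1 H1 ip1 x - g x)"
      using R11.minimizer_mem[OF f1] R12.minimizer_mem[OF g]
      by (intro B1.abs_le_ip_norm B1.diff_mem)
    also have "\<dots> \<le> \<kappa> * (?c * \<kappa> / \<tau> * (?T + \<bar>lam1 - lam2\<bar> / \<tau>))"
      by (intro mult_left_mono B1.kappa_ge_zero
          R11.minimizer_perturbation[OF C2.convex_lipschitz_loss_axioms sets f1 g tau])
    also have "\<dots> = ?c / \<tau> * (\<kappa>\<^sup>2 * ?T + \<kappa>\<^sup>2 / \<tau> * \<bar>lam1 - lam2\<bar>)"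
      by (simp add: power2_eq_square algebra_simps)
    finally have 1: "\<bar>svm L P1 lam1 H1 ip1 x - g x\<bar>
        \<le> ?c / \<tau> * (\<kappa>\<^sup>2 * ?T + \<kappa>\<^sup>2 / \<tau> * \<bar>lam1 - lam2\<bar>)" .
    have "\<bar>g x - svm L P2 lam2 H2 ip2 x\<bar> \<le> ?c / lam2 * (D / 2 + \<kappa> * sqrt D)"
      by (rule kernel_perturbation[OF R12.regularized_risk_axioms R22.regularized_risk_axioms
            g f2 \<open>lam2 > 0\<close> D])
    \<comment> \<open>The kernel was changed at parameter \<open>lam2\<close>; passing to the
      smaller \<open>\<tau>\<close> gives the common prefactor.\<close>
    also have "\<dots> \<le> ?c / \<tau> * (D / 2 + \<kappa> * sqrt D)"
      using tau C1.const_ge_zero B1.kappa_ge_zero D0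
      by (intro mult_right_mono divide_left_mono add_nonneg_nonneg mult_nonneg_nonneg) auto
    finally show ?thesis
      using 1 by (simp add: distrib_left)
  qed
  then show ?thesis
    unfolding sup_norm_def[of "\<lambda>x. svm L P1 lam1 H1 ip1 x - svm L P2 lam2 H2 ip2 x"]
    by (intro cSUP_least) (simp_all add: D_def)
qed

end
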